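(* Let $M$ be a STCR lightlike submanifold of an indefinite Kähler manifold $\bar M$. Then $\tilde D$ defines a totally geodesic foliation on $M$ if and only if $A_{\omega Y}X\in\Gamma(\tilde D)$ for all $X,Y\in\Gamma(\tilde D)$.
   Context: Indefinite Kähler manifold $(\bar M,\bar J,\bar g)$: a semi-Riemannian manifold of constant index $q$, $0<q<\dim\bar M$, with an almost complex structure $\bar J$ ($\bar J^2=-I$) satisfying $\bar g(\bar JX,\bar JY)=\bar g(X,Y)$ and $\bar\nabla\bar J=0$, where $\bar\nabla$ is the Levi-Civita connection of $\bar g$. Lightlike submanifold: a submanifold $M$ of dimension $m$ of $\bar M$ (of dimension $m+n$), with induced metric $g$, such that $Rad(TM)=TM\cap TM^\perp$ has constant rank $r$, $1\le r\le m$. One fixes non-degenerate complements: a screen distribution $S(TM)$ with $TM=S(TM)\perp Rad(TM)$ and a screen transversal bundle $S(TM^\perp)$ with $TM^\perp=S(TM^\perp)\perp Rad(TM)$. The lightlike transversal bundle $ltr(TM)$ is a rank $r$ complement of $Rad(TM)$ in the orthogonal complement of $S(TM)\perp S(TM^\perp)$ in $T\bar M|_M$, locally spanned by $N_1,\dots,N_r$ with $\bar g(\xi_i,N_j)=\delta_{ij}$, $\bar g(N_i,N_j)=0$ for a local basis $\{\xi_i\}$ of $Rad(TM)$. Put $tr(TM)=ltr(TM)\perp S(TM^\perp)$; then $T\bar M|_M=TM\oplus tr(TM)$. STCR (screen transversal Cauchy Riemann) lightlike submanifold: a real lightlike submanifold $M$ of $\bar M$ such that (A) there are subbundles $D_1,D_2$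 of $Rad(TM)$ with $Rad(TM)=D_1\oplus D_2$, $\bar J(D_1)\subset S(TM)$, $\bar J(D_2)\subset S(TM^\perp)$; (B) there are subbundles $D_0,D'$ of $S(TM)$ with $S(TM)=\{\bar JD_1\oplus D'\}\perp D_0$, $\bar J(D_0)=D_0$, $\bar J(D')=L_1\perp S$, where $D_0$ is non-degenerate and $L_1$, $S$ are vector subbundles of $ltr(TM)$ and $S(TM^\perp)$ respectively. Moreover $ltr(TM)=L_1\oplus L_2$ with $\bar J(L_1)\subset S(TM)$, $\bar J(L_2)\subset S(TM^\perp)$, and $S(TM^\perp)=\{\bar J(D_2)\oplus\bar J(L_2)\}\perp S$. Then $TM=D\oplus\tilde D$, where $D=D_0\oplus D_1\oplus\bar JD_1$ is $\bar J$-invariant and $\tilde D=D_2\oplus\bar JL_1\oplus\bar JS$ satisfies $\bar J\tilde D\subset tr(TM)$. Gauss–Weingarten formulas (for $X,Y\in\Gamma(TM)$, $V\in\Gamma(tr(TM))$): $\bar\nabla_XY=\nabla_XY+h(X,Y)$ and $\bar\nabla_XV=-A_VX+\nabla^t_XV$, with $\nabla_XY,A_VX\in\Gamma(TM)$ and $h(X,Y),\nabla^t_XV\in\Gamma(tr(TM))$. For $Y\in\Gamma(TM)$, $\omega Y$ denotes the $tr(TM)$-component of $\bar JY$ in $T\bar M|_M=TM\oplus tr(TM)$. $\tilde D$ defines a totally geodesic foliation on $M$ if $\nabla_XY\in\Gamma(\tilde D)$ for all $X,Y\in\Gamma(\tilde D)$. *)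

theory Defs
  imports "HOL-Analysis.Analysis"
begin

section \<open>Smooth manifolds\<close>

text \<open>The set U is always open where these are used.\<close>

fun Ck_on :: "nat \<Rightarrow> 'a::euclidean_space set \<Rightarrow> ('a \<Rightarrow> 'b::real_normed_vector) \<Rightarrow> bool" where
  "Ck_on 0 U f \<longleftrightarrow> continuous_on U f"
| "Ck_on (Suc k) U f \<longleftrightarrow> (\<forall>x\<in>U. f differentiable (at x)) \<and>
     (\<forall>b\<in>Basis. Ck_on k U (\<lambda>x. frechet_derivative f (at x) b))"

definition smooth_on :: "'a::euclidean_space set \<Rightarrow> ('a \<Rightarrow> 'b::real_normed_vector) \<Rightarrow> bool" where
  "smooth_on U f \<longleftrightarrow> (\<forall>k. Ck_on k U f)"

text \<open>A manifold is a Hausdorff second countable type together with a smooth atlas on it.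
  Its dimension is the dimension of the model space \<open>'e\<close>.\<close>

type_synonym ('a, 'e) chart = "'a set \<times> ('a \<Rightarrow> 'e)"

abbreviation cdom :: "('a, 'e) chart \<Rightarrow> 'a set" where
  "cdom c \<equiv> fst c"

abbreviation cmap :: "('a, 'e) chart \<Rightarrow> 'a \<Rightarrow> 'e" where
  "cmap c \<equiv> snd c"

definition cinv :: "('a, 'e) chart \<Rightarrow> 'e \<Rightarrow> 'a" where
  "cinv c = inv_into (cdom c) (cmap c)"

definition smooth_atlas ::
  "('a::{second_countable_topology,t2_space}, 'e::euclidean_space) chart set \<Rightarrow> bool" where
  "smooth_atlas M \<longleftrightarrow>
     (\<Union>c\<in>M. cdom c) = UNIV \<and>
     (\<forall>c\<in>M. open (cdom c) \<and> open (cmap c ` cdom c) \<and>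
        homeomorphism (cdom c) (cmap c ` cdom c) (cmap c) (cinv c)) \<and>
     (\<forall>c\<in>M. \<forall>d\<in>M. smooth_on (cmap c ` (cdom c \<inter> cdom d)) (cmap d \<circ> cinv c))"

text \<open>Every tangent space is modelled on \<open>'e\<close>: a tangent vector at p is given by its components
  in a chart chosen once and for all around p. Its components in any other chart c are
  then obtained with the Jacobian of the change of charts. A vector field is a function
  from points to \<open>'e\<close>.\<close>

definition chart_at :: "('a, 'e) chart set \<Rightarrow> 'a \<Rightarrow> ('a, 'e) chart" where
  "chart_at M p = (SOME c. c \<in> M \<and> p \<in> cdom c)"

definition components ::
  "('a, 'e::euclidean_space) chart set \<Rightarrow> ('a, 'e) chart \<Rightarrow> 'a \<Rightarrow> 'e \<Rightarrow> 'e" where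
  "components M c p v =
     frechet_derivative (cmap c \<circ> cinv (chart_at M p)) (at (cmap (chart_at M p) p)) v"

text \<open>The vector field on the domain of c with constant components u in the chart c;
  for basis vectors u these are the coordinate fields.\<close>

definition coord_field ::
  "('a, 'e::euclidean_space) chart set \<Rightarrow> ('a, 'e) chart \<Rightarrow> 'e \<Rightarrow> 'a \<Rightarrow> 'e" where
  "coord_field M c u p =
     frechet_derivative (cmap (chart_at M p) \<circ> cinv c) (at (cmap c p)) u"

definition smooth_fun ::
  "('a, 'e::euclidean_space) chart set \<Rightarrow> 'a set \<Rightarrow> ('a \<Rightarrow> real) \<Rightarrow> bool" where
  "smooth_fun M U h \<longleftrightarrow> (\<forall>c\<in>M. smooth_on (cmap c ` (U \<inter> cdom c)) (h \<circ> cinv c))"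

definition smooth_field ::
  "('a, 'e::euclidean_space) chart set \<Rightarrow> 'a set \<Rightarrow> ('a \<Rightarrow> 'e) \<Rightarrow> bool" where
  "smooth_field M U X \<longleftrightarrow>
     (\<forall>c\<in>M. smooth_on (cmap c ` (U \<inter> cdom c)) (\<lambda>x. components M c (cinv c x) (X (cinv c x))))"

text \<open>The derivative v(h) of a function h in the direction of a tangent vector v at p.\<close>

definition dir_deriv ::
  "('a, 'e::euclidean_space) chart set \<Rightarrow> 'a \<Rightarrow> 'e \<Rightarrow> ('a \<Rightarrow> real) \<Rightarrow> real" where
  "dir_deriv M p v h =
     frechet_derivative (h \<circ> cinv (chart_at M p)) (at (cmap (chart_at M p) p)) v"


section \<open>Linear algebra\<close>

definition ssum :: "'e::real_vector set \<Rightarrow> 'e set \<Rightarrow> 'e set" where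
  "ssum V W = {v + w |v w. v \<in> V \<and> w \<in> W}"

definition direct_sum :: "'e::real_vector set \<Rightarrow> 'e set \<Rightarrow> 'e set \<Rightarrow> bool" where
  "direct_sum E V W \<longleftrightarrow> E = ssum V W \<and> V \<inter> W = {0}"

definition orth_sum ::
  "('e::real_vector \<Rightarrow> 'e \<Rightarrow> real) \<Rightarrow> 'e set \<Rightarrow> 'e set \<Rightarrow> 'e set \<Rightarrow> bool" where
  "orth_sum b E V W \<longleftrightarrow> direct_sum E V W \<and> (\<forall>v\<in>V. \<forall>w\<in>W. b v w = 0)"

definition nondegenerate_on :: "('e::real_vector \<Rightarrow> 'e \<Rightarrow> real) \<Rightarrow> 'e set \<Rightarrow> bool" where
  "nondegenerate_on b V \<longleftrightarrow> (\<forall>v\<in>V. (\<forall>w\<in>V. b v w = 0) \<longrightarrow> v = 0)"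

definition orth_compl :: "('e::real_vector \<Rightarrow> 'e \<Rightarrow> real) \<Rightarrow> 'e set \<Rightarrow> 'e set" where
  "orth_compl b V = {w. \<forall>v\<in>V. b v w = 0}"

definition negative_definite_on :: "('e::real_vector \<Rightarrow> 'e \<Rightarrow> real) \<Rightarrow> 'e set \<Rightarrow> bool" where
  "negative_definite_on b V \<longleftrightarrow> (\<forall>v\<in>V. v \<noteq> 0 \<longrightarrow> b v v < 0)"

definition has_index :: "('e::euclidean_space \<Rightarrow> 'e \<Rightarrow> real) \<Rightarrow> nat \<Rightarrow> bool" where
  "has_index b q \<longleftrightarrow>
     (\<exists>V. subspace V \<and> negative_definite_on b V \<and> dim V = q) \<and>
     (\<forall>V. subspace V \<and> negative_definite_on b V \<longrightarrow> dim V \<le> q)"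

text \<open>The V-component of x with respect to a direct sum decomposition into V and W.\<close>

definition component :: "'e::real_vector set \<Rightarrow> 'e set \<Rightarrow> 'e \<Rightarrow> 'e" where
  "component V W x = (THE v. v \<in> V \<and> x - v \<in> W)"


section \<open>Indefinite Kaehler manifolds\<close>

text \<open>Smoothness of tensor fields is tested on vector fields defined on open subsets.\<close>

definition semi_riemannian ::
  "('a::{second_countable_topology,t2_space}, 'e::euclidean_space) chart set \<Rightarrow>
   ('a \<Rightarrow> 'e \<Rightarrow> 'e \<Rightarrow> real) \<Rightarrow> nat \<Rightarrow> bool" where
  "semi_riemannian M g q \<longleftrightarrow>
     smooth_atlas M \<and>
     (\<forall>p. bilinear (g p) \<and> (\<forall>v w. g p v w = g p w v) \<and>
          nondegenerate_on (g p) UNIV \<and> has_index (g p) q) \<and>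
     (\<forall>U X Y. open U \<and> smooth_field M U X \<and> smooth_field M U Y \<longrightarrow>
        smooth_fun M U (\<lambda>p. g p (X p) (Y p)))"

definition almost_complex ::
  "('a::{second_countable_topology,t2_space}, 'e::euclidean_space) chart set \<Rightarrow>
   ('a \<Rightarrow> 'e \<Rightarrow> 'e) \<Rightarrow> bool" where
  "almost_complex M J \<longleftrightarrow>
     (\<forall>p. linear (J p) \<and> (\<forall>v. J p (J p v) = - v)) \<and>
     (\<forall>U X. open U \<and> smooth_field M U X \<longrightarrow> smooth_field M U (\<lambda>p. J p (X p)))"

text \<open>Linear connections. A connection acts on the vector fields of every open subset U. As
  fields are total functions, fields on U are functions that are smooth on U and arbitrary
  elsewhere; compatibility with restriction to smaller open sets follows from the function
  linearity and Leibniz conditions, applied to the indicator function of the smaller set.\<close>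

definition linear_connection ::
  "('a::{second_countable_topology,t2_space}, 'e::euclidean_space) chart set \<Rightarrow>
   (('a \<Rightarrow> 'e) \<Rightarrow> ('a \<Rightarrow> 'e) \<Rightarrow> 'a \<Rightarrow> 'e) \<Rightarrow> bool" where
  "linear_connection M nab \<longleftrightarrow>
     (\<forall>U X Y Z h. open U \<and> smooth_field M U X \<and> smooth_field M U Y \<and> smooth_field M U Z \<and>
        smooth_fun M U h \<longrightarrow>
        smooth_field M U (nab X Y) \<and>
        (\<forall>p\<in>U.
           nab (\<lambda>x. X x + Y x) Z p = nab X Z p + nab Y Z p \<and>
           nab (\<lambda>x. h x *\<^sub>R X x) Y p = h p *\<^sub>R nab X Y p \<and>
           nab X (\<lambda>x. Y x + Z x) p = nab X Y p + nab X Z p \<and>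
           nab X (\<lambda>x. h x *\<^sub>R Y x) p = dir_deriv M p (X p) h *\<^sub>R Y p + h p *\<^sub>R nab X Y p))"

definition torsion_free ::
  "('a::{second_countable_topology,t2_space}, 'e::euclidean_space) chart set \<Rightarrow>
   (('a \<Rightarrow> 'e) \<Rightarrow> ('a \<Rightarrow> 'e) \<Rightarrow> 'a \<Rightarrow> 'e) \<Rightarrow> bool" where
  "torsion_free M nab \<longleftrightarrow>
     (\<forall>U X Y h. open U \<and> smooth_field M U X \<and> smooth_field M U Y \<and> smooth_fun M U h \<longrightarrow>
        (\<forall>p\<in>U. dir_deriv M p (nab X Y p - nab Y X p) h =
           dir_deriv M p (X p) (\<lambda>x. dir_deriv M x (Y x) h) -
           dir_deriv M p (Y p) (\<lambda>x. dir_deriv M x (X x) h)))"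

definition metric_connection ::
  "('a::{second_countable_topology,t2_space}, 'e::euclidean_space) chart set \<Rightarrow>
   ('a \<Rightarrow> 'e \<Rightarrow> 'e \<Rightarrow> real) \<Rightarrow> (('a \<Rightarrow> 'e) \<Rightarrow> ('a \<Rightarrow> 'e) \<Rightarrow> 'a \<Rightarrow> 'e) \<Rightarrow> bool" where
  "metric_connection M g nab \<longleftrightarrow>
     (\<forall>U X Y Z. open U \<and> smooth_field M U X \<and> smooth_field M U Y \<and> smooth_field M U Z \<longrightarrow>
        (\<forall>p\<in>U. dir_deriv M p (X p) (\<lambda>x. g x (Y x) (Z x)) =
           g p (nab X Y p) (Z p) + g p (Y p) (nab X Z p)))"

definition levi_civita ::
  "('a::{second_countable_topology,t2_space}, 'e::euclidean_space) chart set \<Rightarrow>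
   ('a \<Rightarrow> 'e \<Rightarrow> 'e \<Rightarrow> real) \<Rightarrow> (('a \<Rightarrow> 'e) \<Rightarrow> ('a \<Rightarrow> 'e) \<Rightarrow> 'a \<Rightarrow> 'e) \<Rightarrow> bool" where
  "levi_civita M g nab \<longleftrightarrow>
     linear_connection M nab \<and> torsion_free M nab \<and> metric_connection M g nab"

definition indefinite_kaehler ::
  "('a::{second_countable_topology,t2_space}, 'e::euclidean_space) chart set \<Rightarrow>
   ('a \<Rightarrow> 'e \<Rightarrow> 'e \<Rightarrow> real) \<Rightarrow> ('a \<Rightarrow> 'e \<Rightarrow> 'e) \<Rightarrow>
   (('a \<Rightarrow> 'e) \<Rightarrow> ('a \<Rightarrow> 'e) \<Rightarrow> 'a \<Rightarrow> 'e) \<Rightarrow> nat \<Rightarrow> bool" where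
  "indefinite_kaehler M g J nab q \<longleftrightarrow>
     semi_riemannian M g q \<and> 0 < q \<and> q < DIM('e) \<and>
     almost_complex M J \<and>
     (\<forall>p v w. g p (J p v) (J p w) = g p v w) \<and>
     levi_civita M g nab \<and>
     (\<forall>U X Y. open U \<and> smooth_field M U X \<and> smooth_field M U Y \<longrightarrow>
        (\<forall>p\<in>U. nab X (\<lambda>x. J x (Y x)) p = J p (nab X Y p)))"


section \<open>Immersed submanifolds\<close>

text \<open>A submanifold of Mbar is a manifold M with an immersion \<open>\<iota>\<close> into Mbar. Vector fields along
  \<open>\<iota>\<close>, that is, sections of the restriction of the tangent bundle of Mbar to M, are
  functions from points p of M to the tangent space of Mbar at \<open>\<iota> p\<close>. The tangent bundle TM
  is identified with its image under the differential of \<open>\<iota>\<close>.\<close>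

definition smooth_map ::
  "('b::topological_space, 'd::euclidean_space) chart set \<Rightarrow>
   ('a::topological_space, 'e::euclidean_space) chart set \<Rightarrow> ('b \<Rightarrow> 'a) \<Rightarrow> bool" where
  "smooth_map M Mbar \<iota> \<longleftrightarrow>
     continuous_on UNIV \<iota> \<and>
     (\<forall>d\<in>M. \<forall>c\<in>Mbar. smooth_on (cmap d ` (cdom d \<inter> \<iota> -` cdom c)) (cmap c \<circ> \<iota> \<circ> cinv d))"

definition differential ::
  "('b, 'd::euclidean_space) chart set \<Rightarrow> ('a, 'e::euclidean_space) chart set \<Rightarrow> ('b \<Rightarrow> 'a) \<Rightarrow>
   'b \<Rightarrow> 'd \<Rightarrow> 'e" where
  "differential M Mbar \<iota> p v =
     frechet_derivative (cmap (chart_at Mbar (\<iota> p)) \<circ> \<iota> \<circ> cinv (chart_at M p))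
       (at (cmap (chart_at M p) p)) v"

definition immersed_submanifold ::
  "('b::{second_countable_topology,t2_space}, 'd::euclidean_space) chart set \<Rightarrow>
   ('a::{second_countable_topology,t2_space}, 'e::euclidean_space) chart set \<Rightarrow>
   ('b \<Rightarrow> 'a) \<Rightarrow> bool" where
  "immersed_submanifold M Mbar \<iota> \<longleftrightarrow>
     smooth_atlas M \<and> smooth_map M Mbar \<iota> \<and> (\<forall>p. inj (differential M Mbar \<iota> p))"

definition tangent_bundle ::
  "('b, 'd::euclidean_space) chart set \<Rightarrow> ('a, 'e::euclidean_space) chart set \<Rightarrow> ('b \<Rightarrow> 'a) \<Rightarrow>
   'b \<Rightarrow> 'e set" where
  "tangent_bundle M Mbar \<iota> p = range (differential M Mbar \<iota> p)"

definition smooth_along ::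
  "('b, 'd::euclidean_space) chart set \<Rightarrow> ('a, 'e::euclidean_space) chart set \<Rightarrow> ('b \<Rightarrow> 'a) \<Rightarrow>
   'b set \<Rightarrow> ('b \<Rightarrow> 'e) \<Rightarrow> bool" where
  "smooth_along M Mbar \<iota> U W \<longleftrightarrow>
     (\<forall>d\<in>M. \<forall>c\<in>Mbar. smooth_on (cmap d ` (U \<inter> cdom d \<inter> \<iota> -` cdom c))
        (\<lambda>x. components Mbar c (\<iota> (cinv d x)) (W (cinv d x))))"

text \<open>The (global, smooth) sections of a subbundle E.\<close>

definition sections ::
  "('b, 'd::euclidean_space) chart set \<Rightarrow> ('a, 'e::euclidean_space) chart set \<Rightarrow> ('b \<Rightarrow> 'a) \<Rightarrow>
   ('b \<Rightarrow> 'e set) \<Rightarrow> ('b \<Rightarrow> 'e) set" where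
  "sections M Mbar \<iota> E = {W. smooth_along M Mbar \<iota> UNIV W \<and> (\<forall>p. W p \<in> E p)}"

text \<open>The k spanning fields form a basis at every point because the fibres have dimension k.\<close>

definition local_frame ::
  "('b, 'd::euclidean_space) chart set \<Rightarrow> ('a, 'e::euclidean_space) chart set \<Rightarrow> ('b \<Rightarrow> 'a) \<Rightarrow>
   ('b \<Rightarrow> 'e set) \<Rightarrow> 'b set \<Rightarrow> nat \<Rightarrow> (nat \<Rightarrow> 'b \<Rightarrow> 'e) \<Rightarrow> bool" where
  "local_frame M Mbar \<iota> E U k s \<longleftrightarrow>
     (\<forall>i<k. smooth_along M Mbar \<iota> U (s i)) \<and>
     (\<forall>x\<in>U. E x = span ((\<lambda>i. s i x) ` {..<k}) \<and> dim (E x) = k)"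

definition subbundle ::
  "('b::topological_space, 'd::euclidean_space) chart set \<Rightarrow>
   ('a, 'e::euclidean_space) chart set \<Rightarrow> ('b \<Rightarrow> 'a) \<Rightarrow> ('b \<Rightarrow> 'e set) \<Rightarrow> bool" where
  "subbundle M Mbar \<iota> E \<longleftrightarrow>
     (\<exists>k. \<forall>p. \<exists>U s. open U \<and> p \<in> U \<and> local_frame M Mbar \<iota> E U k s)"

text \<open>The connection along \<open>\<iota>\<close> induced by a connection nab of Mbar, for X tangent to M and W a
  vector field along \<open>\<iota>\<close>. Writing W as the sum of its component functions w times the coordinate
  fields of a chart c around \<open>\<iota> p\<close>, the value at p is the sum of X(w) times the coordinate
  fields and of w times their covariant derivatives in the direction of X. For c the chart
  chosen at \<open>\<iota> p\<close>, components in c and vectors of the tangent space at \<open>\<iota> p\<close> are the same.\<close>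

definition induced_connection ::
  "('b, 'd::euclidean_space) chart set \<Rightarrow> ('a, 'e::euclidean_space) chart set \<Rightarrow> ('b \<Rightarrow> 'a) \<Rightarrow>
   (('a \<Rightarrow> 'e) \<Rightarrow> ('a \<Rightarrow> 'e) \<Rightarrow> 'a \<Rightarrow> 'e) \<Rightarrow>
   ('b \<Rightarrow> 'e) \<Rightarrow> ('b \<Rightarrow> 'e) \<Rightarrow> 'b \<Rightarrow> 'e" where
  "induced_connection M Mbar \<iota> nab X W p =
     (let c = chart_at Mbar (\<iota> p);
          d = chart_at M p;
          v = inv (differential M Mbar \<iota> p) (X p);
          w = (\<lambda>x. components Mbar c (\<iota> x) (W x))
      in frechet_derivative (w \<circ> cinv d) (at (cmap d p)) v +
         (\<Sum>b\<in>Basis. (w p \<bullet> b) *\<^sub>R nab (coord_field Mbar c (X p)) (coord_field Mbar c b) (\<iota> p)))"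


section \<open>Lightlike submanifolds\<close>

definition normal_bundle ::
  "('b, 'd::euclidean_space) chart set \<Rightarrow> ('a, 'e::euclidean_space) chart set \<Rightarrow> ('b \<Rightarrow> 'a) \<Rightarrow>
   ('a \<Rightarrow> 'e \<Rightarrow> 'e \<Rightarrow> real) \<Rightarrow> 'b \<Rightarrow> 'e set" where
  "normal_bundle M Mbar \<iota> g p = orth_compl (g (\<iota> p)) (tangent_bundle M Mbar \<iota> p)"

definition radical ::
  "('b, 'd::euclidean_space) chart set \<Rightarrow> ('a, 'e::euclidean_space) chart set \<Rightarrow> ('b \<Rightarrow> 'a) \<Rightarrow>
   ('a \<Rightarrow> 'e \<Rightarrow> 'e \<Rightarrow> real) \<Rightarrow> 'b \<Rightarrow> 'e set" where
  "radical M Mbar \<iota> g p = tangent_bundle M Mbar \<iota> p \<inter> normal_bundle M Mbar \<iota> g p"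

definition lightlike_submanifold ::
  "('b::{second_countable_topology,t2_space}, 'd::euclidean_space) chart set \<Rightarrow>
   ('a::{second_countable_topology,t2_space}, 'e::euclidean_space) chart set \<Rightarrow>
   ('b \<Rightarrow> 'a) \<Rightarrow> ('a \<Rightarrow> 'e \<Rightarrow> 'e \<Rightarrow> real) \<Rightarrow> nat \<Rightarrow> bool" where
  "lightlike_submanifold M Mbar \<iota> g r \<longleftrightarrow>
     immersed_submanifold M Mbar \<iota> \<and> 1 \<le> r \<and> r \<le> DIM('d) \<and>
     (\<forall>p. dim (radical M Mbar \<iota> g p) = r)"

text \<open>\<open>STM\<close> is the screen distribution S(TM) and \<open>STMp\<close> the screen transversal bundle, i.e.
  the screen of the normal bundle.\<close>

definition screens ::
  "('b::{second_countable_topology,t2_space}, 'd::euclidean_space) chart set \<Rightarrow>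
   ('a::{second_countable_topology,t2_space}, 'e::euclidean_space) chart set \<Rightarrow>
   ('b \<Rightarrow> 'a) \<Rightarrow> ('a \<Rightarrow> 'e \<Rightarrow> 'e \<Rightarrow> real) \<Rightarrow> ('b \<Rightarrow> 'e set) \<Rightarrow> ('b \<Rightarrow> 'e set) \<Rightarrow> bool" where
  "screens M Mbar \<iota> g STM STMp \<longleftrightarrow>
     subbundle M Mbar \<iota> STM \<and> subbundle M Mbar \<iota> STMp \<and>
     (\<forall>p. nondegenerate_on (g (\<iota> p)) (STM p) \<and> nondegenerate_on (g (\<iota> p)) (STMp p) \<and>
        orth_sum (g (\<iota> p)) (tangent_bundle M Mbar \<iota> p) (STM p) (radical M Mbar \<iota> g p) \<and>
        orth_sum (g (\<iota> p)) (normal_bundle M Mbar \<iota> g p) (STMp p) (radical M Mbar \<iota> g p))"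

definition lightlike_transversal ::
  "('b::{second_countable_topology,t2_space}, 'd::euclidean_space) chart set \<Rightarrow>
   ('a::{second_countable_topology,t2_space}, 'e::euclidean_space) chart set \<Rightarrow>
   ('b \<Rightarrow> 'a) \<Rightarrow> ('a \<Rightarrow> 'e \<Rightarrow> 'e \<Rightarrow> real) \<Rightarrow> nat \<Rightarrow> ('b \<Rightarrow> 'e set) \<Rightarrow> ('b \<Rightarrow> 'e set) \<Rightarrow>
   ('b \<Rightarrow> 'e set) \<Rightarrow> bool" where
  "lightlike_transversal M Mbar \<iota> g r STM STMp ltr \<longleftrightarrow>
     (\<forall>p. direct_sum (orth_compl (g (\<iota> p)) (ssum (STM p) (STMp p)))
            (radical M Mbar \<iota> g p) (ltr p)) \<and>
     (\<forall>p. \<exists>U \<xi> N. open U \<and> p \<in> U \<and>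
        local_frame M Mbar \<iota> (radical M Mbar \<iota> g) U r \<xi> \<and>
        local_frame M Mbar \<iota> ltr U r N \<and>
        (\<forall>x\<in>U. \<forall>i<r. \<forall>j<r.
           g (\<iota> x) (\<xi> i x) (N j x) = (if i = j then 1 else 0) \<and>
           g (\<iota> x) (N i x) (N j x) = 0))"

definition transversal :: "('b \<Rightarrow> 'e::real_vector set) \<Rightarrow> ('b \<Rightarrow> 'e set) \<Rightarrow> 'b \<Rightarrow> 'e set" where
  "transversal STMp ltr p = ssum (ltr p) (STMp p)"


section \<open>STCR lightlike submanifolds\<close>

definition stcr ::
  "('b::{second_countable_topology,t2_space}, 'd::euclidean_space) chart set \<Rightarrow>
   ('a::{second_countable_topology,t2_space}, 'e::euclidean_space) chart set \<Rightarrow>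
   ('b \<Rightarrow> 'a) \<Rightarrow> ('a \<Rightarrow> 'e \<Rightarrow> 'e \<Rightarrow> real) \<Rightarrow> ('a \<Rightarrow> 'e \<Rightarrow> 'e) \<Rightarrow>
   ('b \<Rightarrow> 'e set) \<Rightarrow> ('b \<Rightarrow> 'e set) \<Rightarrow> ('b \<Rightarrow> 'e set) \<Rightarrow>
   ('b \<Rightarrow> 'e set) \<Rightarrow> ('b \<Rightarrow> 'e set) \<Rightarrow> ('b \<Rightarrow> 'e set) \<Rightarrow> ('b \<Rightarrow> 'e set) \<Rightarrow>
   ('b \<Rightarrow> 'e set) \<Rightarrow> ('b \<Rightarrow> 'e set) \<Rightarrow> ('b \<Rightarrow> 'e set) \<Rightarrow> bool" where
  "stcr M Mbar \<iota> g J STM STMp ltr D1 D2 D0 D' L1 L2 S \<longleftrightarrow>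
     subbundle M Mbar \<iota> D1 \<and> subbundle M Mbar \<iota> D2 \<and>
     subbundle M Mbar \<iota> D0 \<and> subbundle M Mbar \<iota> D' \<and>
     subbundle M Mbar \<iota> L1 \<and> subbundle M Mbar \<iota> L2 \<and> subbundle M Mbar \<iota> S \<and>
     (\<forall>p. direct_sum (radical M Mbar \<iota> g p) (D1 p) (D2 p) \<and>
        J (\<iota> p) ` D1 p \<subseteq> STM p \<and> J (\<iota> p) ` D2 p \<subseteq> STMp p) \<and>
     (\<forall>p. D0 p \<subseteq> STM p \<and> D' p \<subseteq> STM p \<and> L1 p \<subseteq> ltr p \<and> S p \<subseteq> STMp p \<and>
        (\<exists>K. direct_sum K (J (\<iota> p) ` D1 p) (D' p) \<and> orth_sum (g (\<iota> p)) (STM p) K (D0 p)) \<and>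
        J (\<iota> p) ` D0 p = D0 p \<and> nondegenerate_on (g (\<iota> p)) (D0 p) \<and>
        orth_sum (g (\<iota> p)) (J (\<iota> p) ` D' p) (L1 p) (S p)) \<and>
     (\<forall>p. direct_sum (ltr p) (L1 p) (L2 p) \<and>
        J (\<iota> p) ` L1 p \<subseteq> STM p \<and> J (\<iota> p) ` L2 p \<subseteq> STMp p \<and>
        (\<exists>K. direct_sum K (J (\<iota> p) ` D2 p) (J (\<iota> p) ` L2 p) \<and>
             orth_sum (g (\<iota> p)) (STMp p) K (S p)))"

definition D_tilde ::
  "('b \<Rightarrow> 'a) \<Rightarrow> ('a \<Rightarrow> 'e::real_vector \<Rightarrow> 'e) \<Rightarrow>
   ('b \<Rightarrow> 'e set) \<Rightarrow> ('b \<Rightarrow> 'e set) \<Rightarrow> ('b \<Rightarrow> 'e set) \<Rightarrow> 'b \<Rightarrow> 'e set" where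
  "D_tilde \<iota> J D2 L1 S p = ssum (ssum (D2 p) (J (\<iota> p) ` L1 p)) (J (\<iota> p) ` S p)"

text \<open>The Gauss and Weingarten formulas. Since the tangent bundle of Mbar along M is the direct
  sum of TM and the transversal bundle tr, they determine \<open>nabM\<close>, \<open>h\<close>, \<open>shape\<close> (shape V X
  is the usual A with index V, applied to X) and \<open>nabt\<close> on sections.\<close>

definition gauss_weingarten ::
  "('b::{second_countable_topology,t2_space}, 'd::euclidean_space) chart set \<Rightarrow>
   ('a::{second_countable_topology,t2_space}, 'e::euclidean_space) chart set \<Rightarrow>
   ('b \<Rightarrow> 'a) \<Rightarrow> (('a \<Rightarrow> 'e) \<Rightarrow> ('a \<Rightarrow> 'e) \<Rightarrow> 'a \<Rightarrow> 'e) \<Rightarrow> ('b \<Rightarrow> 'e set) \<Rightarrow>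
   (('b \<Rightarrow> 'e) \<Rightarrow> ('b \<Rightarrow> 'e) \<Rightarrow> 'b \<Rightarrow> 'e) \<Rightarrow> (('b \<Rightarrow> 'e) \<Rightarrow> ('b \<Rightarrow> 'e) \<Rightarrow> 'b \<Rightarrow> 'e) \<Rightarrow>
   (('b \<Rightarrow> 'e) \<Rightarrow> ('b \<Rightarrow> 'e) \<Rightarrow> 'b \<Rightarrow> 'e) \<Rightarrow> (('b \<Rightarrow> 'e) \<Rightarrow> ('b \<Rightarrow> 'e) \<Rightarrow> 'b \<Rightarrow> 'e) \<Rightarrow> bool" where
  "gauss_weingarten M Mbar \<iota> nab tr nabM h shape nabt \<longleftrightarrow>
     (let \<Gamma> = sections M Mbar \<iota>; TM = tangent_bundle M Mbar \<iota>;
          D = induced_connection M Mbar \<iota> nab in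
      (\<forall>X\<in>\<Gamma> TM. \<forall>Y\<in>\<Gamma> TM.
         nabM X Y \<in> \<Gamma> TM \<and> h X Y \<in> \<Gamma> tr \<and> (\<forall>p. D X Y p = nabM X Y p + h X Y p)) \<and>
      (\<forall>X\<in>\<Gamma> TM. \<forall>V\<in>\<Gamma> tr.
         shape V X \<in> \<Gamma> TM \<and> nabt X V \<in> \<Gamma> tr \<and> (\<forall>p. D X V p = - shape V X p + nabt X V p)))"

definition omega ::
  "('b, 'd::euclidean_space) chart set \<Rightarrow> ('a, 'e::euclidean_space) chart set \<Rightarrow> ('b \<Rightarrow> 'a) \<Rightarrow>
   ('a \<Rightarrow> 'e \<Rightarrow> 'e) \<Rightarrow> ('b \<Rightarrow> 'e set) \<Rightarrow> ('b \<Rightarrow> 'e) \<Rightarrow> 'b \<Rightarrow> 'e" where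
  "omega M Mbar \<iota> J tr Y p = component (tr p) (tangent_bundle M Mbar \<iota> p) (J (\<iota> p) (Y p))"

definition totally_geodesic_foliation ::
  "('b, 'd::euclidean_space) chart set \<Rightarrow> ('a, 'e::euclidean_space) chart set \<Rightarrow> ('b \<Rightarrow> 'a) \<Rightarrow>
   (('b \<Rightarrow> 'e) \<Rightarrow> ('b \<Rightarrow> 'e) \<Rightarrow> 'b \<Rightarrow> 'e) \<Rightarrow> ('b \<Rightarrow> 'e set) \<Rightarrow> bool" where
  "totally_geodesic_foliation M Mbar \<iota> nabM E \<longleftrightarrow>
     (\<forall>X\<in>sections M Mbar \<iota> E. \<forall>Y\<in>sections M Mbar \<iota> E. nabM X Y \<in> sections M Mbar \<iota> E)"

end

theory Submission
  imports Defs
begin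

text \<open>For Y a section of D-tilde, JY is transversal, so \<open>\<omega>Y = JY\<close>. As J is parallel, the induced
  connection along \<open>\<iota>\<close> commutes with J, and the Gauss and Weingarten formulas give
  \<open>- A X + \<nabla>\<^sup>t = J (\<nabla> X Y) + J (h(X,Y))\<close>. The image of the transversal bundle under J has
  tangential part in D-tilde, and so the tangential part of the equation says that A X + J P is in
  D-tilde, P being the D-component of \<open>\<nabla> X Y\<close>. Since D is J-invariant and TM is the direct sum of
  D and D-tilde, A X is in D-tilde iff P = 0, that is, iff \<open>\<nabla> X Y\<close> is in D-tilde.\<close>

section \<open>Calculus of smooth functions\<close>

text \<open>The obstacle is the commutation of the induced connection with J. A field along \<iota>
  is not a field on an open subset of Mbar, so the hypothesis that J is parallel does not apply to
  it. The definition \<open>induced_connection\<close> is therefore unfolded in the chart at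
  \<open>\<iota> p\<close>. There J is a matrix of smooth functions, parallelism is used on
  coordinate fields alone, and the rest is the product rule and the chain rule; the calculus of
  \<open>smooth_on\<close> serves this. In the fibres the key is J^2 = -1: applied to J D' = L1 + S
  it gives D' = J L1 + J S, which places D-tilde inside TM and makes it complete D to TM. The metric
  enters through the trivial intersection of TM with the transversal bundle, which is derived from
  the nondegenerate screen and the dual frames. The equivalence holds for each pair X, Y and at each
  point, so no tangent vector has to be extended to a section. Smoothness of the two resulting
  fields is part of the Gauss and Weingarten formulas.\<close>

lemma frechet_derivative_cong_open:
  assumes "open U" "x \<in> U" "\<And>y. y \<in> U \<Longrightarrow> f y = g y" "f differentiable (at x)"
  shows "frechet_derivative f (at x) = frechet_derivative g (at x)" "g differentiable (at x)"
proof -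
  have "(f has_derivative frechet_derivative f (at x)) (at x)"
    using assms(4) by (simp add: frechet_derivative_works)
  then have "(g has_derivative frechet_derivative f (at x)) (at x)"
    using has_derivative_transform_within_open assms(1-3) by blast
  then show "frechet_derivative f (at x) = frechet_derivative g (at x)" "g differentiable (at x)"
    using frechet_derivative_at differentiable_def by blast+
qed

text \<open>\<open>Ck_on\<close> speaks of derivatives in basis directions only. This expansion
  reaches the other directions, in particular the one that the chain rule feeds to the derivative of
  the outer function.\<close>

lemma frechet_derivative_Basis_expand:
  fixes f :: "'a::euclidean_space \<Rightarrow> 'b::real_normed_vector"
  assumes "f differentiable (at x)"
  shows "frechet_derivative f (at x) v = (\<Sum>b\<in>Basis. (v \<bullet> b) *\<^sub>R frechet_derivative f (at x) b)"
proof -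
  interpret linear "frechet_derivative f (at x)"
    by (rule linear_frechet_derivative[OF assms])
  have "frechet_derivative f (at x) v = frechet_derivative f (at x) (\<Sum>b\<in>Basis. (v \<bullet> b) *\<^sub>R b)"
    by (simp add: euclidean_representation)
  then show ?thesis by (simp add: sum scaleR)
qed

text \<open>\<open>Ck_on\<close> differentiates with the full filter \<open>at x\<close>, so
  agreement on U settles the derivatives because U is open. The induction replaces both functions by
  their partial derivatives, hence \<open>arbitrary: f g\<close>.\<close>

lemma Ck_on_cong:
  assumes "open U" "\<And>x. x \<in> U \<Longrightarrow> f x = g x" "Ck_on k U f"
  shows "Ck_on k U g"
  using assms(2,3)
proof (induction k arbitrary: f g)
  case 0
  then show ?case using continuous_on_cong by fastforce
next
  case (Suc k)
  have fd: "\<And>x. x \<in> U \<Longrightarrow> f differentiable (at x)" using Suc.prems(2) by simp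
  have "Ck_on k U (\<lambda>x. frechet_derivative g (at x) b)" if "b \<in> Basis" for b
  proof (rule Suc.IH)
    show "Ck_on k U (\<lambda>x. frechet_derivative f (at x) b)" using Suc.prems(2) that by simp
    show "frechet_derivative f (at x) b = frechet_derivative g (at x) b" if "x \<in> U" for x
      using frechet_derivative_cong_open(1)[OF assms(1) that Suc.prems(1) fd[OF that]] by simp
  qed
  then show ?case using frechet_derivative_cong_open(2)[OF assms(1) _ Suc.prems(1) fd] by simp
qed

lemma Ck_on_Suc_imp: "Ck_on (Suc k) U f \<Longrightarrow> Ck_on k U f"
proof (induction k arbitrary: f)
  case 0
  then show ?case
    by (simp add: continuous_at_imp_continuous_on differentiable_imp_continuous_within)
next
  case (Suc k)
  then show ?case unfolding Ck_on.simps(2) by blast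
qed

lemma Ck_on_subset: "Ck_on k U f \<Longrightarrow> V \<subseteq> U \<Longrightarrow> Ck_on k V f"
proof (induction k arbitrary: f)
  case 0 then show ?case using continuous_on_subset by auto
next
  case (Suc k) then show ?case by (auto simp: subset_iff)
qed

lemma Ck_on_const: "Ck_on k U (\<lambda>x. c)"
  by (induction k arbitrary: c) (auto)

text \<open>The pattern of this and the following closure proofs: the derivative has an explicit
  formula on U, the formula is of class C^k by the induction hypothesis, and
  \<open>Ck_on_cong\<close> passes this on to \<open>frechet_derivative\<close>.\<close>

lemma Ck_on_add:
  assumes "open U" "Ck_on k U f" "Ck_on k U g"
  shows "Ck_on k U (\<lambda>x. f x + g x)"
  using assms(2,3)
proof (induction k arbitrary: f g)
  case 0 then show ?case by (simp add: continuous_on_add)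
next
  case (Suc k)
  have D: "((\<lambda>x. f x + g x) has_derivative (\<lambda>v. frechet_derivative f (at x) v
      + frechet_derivative g (at x) v)) (at x)" if "x \<in> U" for x
    using Suc.prems that
    by (intro has_derivative_add) (simp_all add: frechet_derivative_works[symmetric])
  have "Ck_on k U (\<lambda>x. frechet_derivative (\<lambda>x. f x + g x) (at x) b)" if b: "b \<in> Basis" for b
  proof (rule Ck_on_cong[OF assms(1)])
    show "Ck_on k U (\<lambda>x. frechet_derivative f (at x) b + frechet_derivative g (at x) b)"
      using Suc b by simp
    show "frechet_derivative f (at x) b + frechet_derivative g (at x) b =
        frechet_derivative (\<lambda>x. f x + g x) (at x) b" if "x \<in> U" for x
      using frechet_derivative_at[OF D[OF that]] by metis
  qed
  then show ?case using Suc.prems by simp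
qed

lemma Ck_on_sum:
  assumes "open U" "finite B" "\<And>b. b \<in> B \<Longrightarrow> Ck_on k U (f b)"
  shows "Ck_on k U (\<lambda>x. \<Sum>b\<in>B. f b x)"
  using assms(2,3)
  by (induction B rule: finite_induct) (simp_all add: Ck_on_const Ck_on_add assms(1))

lemma Ck_on_linear:
  assumes "open U" "bounded_linear L" "Ck_on k U f"
  shows "Ck_on k U (\<lambda>x. L (f x))"
  using assms(3)
proof (induction k arbitrary: f)
  case 0
  then show ?case by (simp add: bounded_linear.continuous_on[OF assms(2)])
next
  case (Suc k)
  have D: "((\<lambda>x. L (f x)) has_derivative (\<lambda>v. L (frechet_derivative f (at x) v))) (at x)"
    if "x \<in> U" for x
    using Suc.prems that
    by (intro bounded_linear.has_derivative[OF assms(2)]) (simp add: frechet_derivative_works[symmetric])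
  have "Ck_on k U (\<lambda>x. frechet_derivative (\<lambda>x. L (f x)) (at x) b)" if b: "b \<in> Basis" for b
  proof (rule Ck_on_cong[OF assms(1)])
    show "Ck_on k U (\<lambda>x. L (frechet_derivative f (at x) b))" using Suc b by simp
    show "L (frechet_derivative f (at x) b) = frechet_derivative (\<lambda>x. L (f x)) (at x) b"
      if "x \<in> U" for x
      using frechet_derivative_at[OF D[OF that]] by metis
  qed
  then show ?case using D by (auto simp: differentiable_def)
qed

lemma Ck_on_scaleR:
  fixes f :: "'a::euclidean_space \<Rightarrow> real"
  assumes "open U" "Ck_on k U f" "Ck_on k U g"
  shows "Ck_on k U (\<lambda>x. f x *\<^sub>R g x)"
  using assms(2,3)
proof (induction k arbitrary: f g)
  case 0 then show ?case by (simp add: continuous_on_scaleR)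
next
  case (Suc k)
  have D: "((\<lambda>x. f x *\<^sub>R g x) has_derivative (\<lambda>v. f x *\<^sub>R frechet_derivative g (at x) v
      + frechet_derivative f (at x) v *\<^sub>R g x)) (at x)" if "x \<in> U" for x
    using Suc.prems that
    by (intro has_derivative_scaleR) (simp_all add: frechet_derivative_works[symmetric])
  have "Ck_on k U (\<lambda>x. frechet_derivative (\<lambda>x. f x *\<^sub>R g x) (at x) b)" if b: "b \<in> Basis" for b
  proof (rule Ck_on_cong[OF assms(1)])
    \<comment> \<open>The product rule brings in f and g themselves, which the induction hypothesis
      needs at order \<open>k\<close>; hence \<open>Ck_on_Suc_imp\<close>.\<close>
    show "Ck_on k U (\<lambda>x. f x *\<^sub>R frechet_derivative g (at x) b
        + frechet_derivative f (at x) b *\<^sub>R g x)"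
      using Suc.prems b Suc.prems[THEN Ck_on_Suc_imp]
      by (intro Ck_on_add[OF assms(1)] Suc.IH) auto
    show "f x *\<^sub>R frechet_derivative g (at x) b + frechet_derivative f (at x) b *\<^sub>R g x =
        frechet_derivative (\<lambda>x. f x *\<^sub>R g x) (at x) b"
      if "x \<in> U" for x
      using frechet_derivative_at[OF D[OF that]] by metis
  qed
  then show ?case using D by (auto simp: differentiable_def)
qed

text \<open>The chain rule gives the derivative of f at a moving point in a moving direction.
  Expanding the direction over the basis separates the two: each summand is a partial derivative of
  f composed with g, covered by the induction hypothesis for arbitrary f, times a coordinate of a
  derivative of g.\<close>

lemma Ck_on_compose:
  fixes g :: "'a::euclidean_space \<Rightarrow> 'b::euclidean_space"
  assumes "open U" "g ` U \<subseteq> V" "Ck_on k V f" "Ck_on k U g"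
  shows "Ck_on k U (f \<circ> g)"
  using assms(3,4)
proof (induction k arbitrary: f)
  case 0
  then show ?case using continuous_on_compose[OF _ continuous_on_subset[OF _ assms(2)]] by auto
next
  case (Suc k)
  have df: "f differentiable (at (g x))" and dg: "g differentiable (at x)" if "x \<in> U" for x
    using Suc.prems assms(2) that by auto
  have "Ck_on k U (\<lambda>x. frechet_derivative (f \<circ> g) (at x) b)" if b: "b \<in> Basis" for b
  proof (rule Ck_on_cong[OF assms(1)])
    show "Ck_on k U (\<lambda>x. \<Sum>i\<in>Basis. (frechet_derivative g (at x) b \<bullet> i) *\<^sub>R
        ((\<lambda>y. frechet_derivative f (at y) i) \<circ> g) x)"
    proof (intro Ck_on_sum Ck_on_scaleR Suc.IH assms(1) finite_Basis)
      fix i :: 'b assume "i \<in> Basis"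
      then show "Ck_on k V (\<lambda>y. frechet_derivative f (at y) i)" using Suc.prems by simp
      show "Ck_on k U g" using Suc.prems(2) by (rule Ck_on_Suc_imp)
      show "Ck_on k U (\<lambda>x. frechet_derivative g (at x) b \<bullet> i)"
        using Suc.prems(2) b by (intro Ck_on_linear[OF assms(1) bounded_linear_inner_left]) simp
    qed
    show "(\<Sum>i\<in>Basis. (frechet_derivative g (at x) b \<bullet> i) *\<^sub>R
        ((\<lambda>y. frechet_derivative f (at y) i) \<circ> g) x) = frechet_derivative (f \<circ> g) (at x) b"
      if "x \<in> U" for x
      using frechet_derivative_Basis_expand[OF df[OF that], of "frechet_derivative g (at x) b"]
      by (simp add: frechet_derivative_compose[OF dg[OF that] df[OF that]])
  qed
  then show ?case unfolding Ck_on.simps using differentiable_chain_at[OF dg df] by blast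
qed

lemma smooth_on_cong:
  "open U \<Longrightarrow> smooth_on U f \<Longrightarrow> (\<And>x. x \<in> U \<Longrightarrow> f x = g x) \<Longrightarrow> smooth_on U g"
  unfolding smooth_on_def using Ck_on_cong by blast

lemma smooth_on_subset: "smooth_on U f \<Longrightarrow> V \<subseteq> U \<Longrightarrow> smooth_on V f"
  unfolding smooth_on_def using Ck_on_subset by blast

lemma smooth_on_const: "smooth_on U (\<lambda>x. c)"
  unfolding smooth_on_def using Ck_on_const by blast

lemma smooth_on_add:
  "open U \<Longrightarrow> smooth_on U f \<Longrightarrow> smooth_on U g \<Longrightarrow> smooth_on U (\<lambda>x. f x + g x)"
  unfolding smooth_on_def using Ck_on_add by blast

lemma smooth_on_sum:
  "open U \<Longrightarrow> finite B \<Longrightarrow> (\<And>b. b \<in> B \<Longrightarrow> smooth_on U (f b)) \<Longrightarrow> smooth_on U (\<lambda>x. \<Sum>b\<in>B. f b x)"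
  unfolding smooth_on_def using Ck_on_sum by blast

lemma smooth_on_inner:
  fixes f :: "'a::euclidean_space \<Rightarrow> 'b::euclidean_space"
  shows "open U \<Longrightarrow> smooth_on U f \<Longrightarrow> smooth_on U (\<lambda>x. f x \<bullet> b)"
  unfolding smooth_on_def using Ck_on_linear[OF _ bounded_linear_inner_left] by blast

lemma smooth_on_scaleR:
  fixes f :: "'a::euclidean_space \<Rightarrow> real"
  shows "open U \<Longrightarrow> smooth_on U f \<Longrightarrow> smooth_on U g \<Longrightarrow> smooth_on U (\<lambda>x. f x *\<^sub>R g x)"
  unfolding smooth_on_def using Ck_on_scaleR by blast

lemma smooth_on_compose:
  fixes g :: "'a::euclidean_space \<Rightarrow> 'b::euclidean_space"
  shows "open U \<Longrightarrow> g ` U \<subseteq> V \<Longrightarrow> smooth_on V f \<Longrightarrow> smooth_on U g \<Longrightarrow> smooth_on U (f \<circ> g)"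
  unfolding smooth_on_def using Ck_on_compose by blast

lemma smooth_on_differentiable: "smooth_on U f \<Longrightarrow> x \<in> U \<Longrightarrow> f differentiable (at x)"
  unfolding smooth_on_def by (meson Ck_on.simps(2))

lemma smooth_on_frechet_derivative:
  assumes "open U" "smooth_on U f"
  shows "smooth_on U (\<lambda>x. frechet_derivative f (at x) v)"
proof (rule smooth_on_cong[OF assms(1)])
  have "smooth_on U (\<lambda>x. frechet_derivative f (at x) b)" if "b \<in> Basis" for b
    using assms(2) that unfolding smooth_on_def by (metis Ck_on.simps(2))
  then show "smooth_on U (\<lambda>x. \<Sum>b\<in>Basis. (v \<bullet> b) *\<^sub>R frechet_derivative f (at x) b)"
    by (intro smooth_on_sum smooth_on_scaleR smooth_on_const assms(1) finite_Basis)
qed (metis assms(2) frechet_derivative_Basis_expand smooth_on_differentiable)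

section \<open>Charts, coordinate fields and smooth fields\<close>

context
  fixes A :: "('a::{second_countable_topology,t2_space}, 'e::euclidean_space) chart set"
  assumes atlas: "smooth_atlas A"
begin

lemma chart_at_mem: "chart_at A p \<in> A" "p \<in> cdom (chart_at A p)"
proof -
  have "\<exists>c. c \<in> A \<and> p \<in> cdom c" using atlas unfolding smooth_atlas_def by blast
  from someI_ex[OF this] show "chart_at A p \<in> A" "p \<in> cdom (chart_at A p)"
    unfolding chart_at_def by blast+
qed

lemma open_cdom: "c \<in> A \<Longrightarrow> open (cdom c)"
  using atlas unfolding smooth_atlas_def by blast

lemma cinv_cmap: "c \<in> A \<Longrightarrow> p \<in> cdom c \<Longrightarrow> cinv c (cmap c p) = p"
  using atlas unfolding smooth_atlas_def homeomorphism_def by blast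

lemma open_cmap_image:
  assumes "c \<in> A" "open V" "V \<subseteq> cdom c"
  shows "open (cmap c ` V)"
proof -
  have h: "open (cmap c ` cdom c)" "homeomorphism (cdom c) (cmap c ` cdom c) (cmap c) (cinv c)"
    using atlas assms(1) unfolding smooth_atlas_def by blast+
  have "openin (top_of_set (cdom c)) V"
    using assms by (simp add: open_cdom openin_open_eq)
  then have "openin (top_of_set (cmap c ` cdom c)) (cmap c ` V)"
    using homeomorphism_imp_open_map[OF h(2)] by blast
  then show ?thesis using h(1) by (meson openin_open_trans)
qed

lemma smooth_transition:
  "c \<in> A \<Longrightarrow> d \<in> A \<Longrightarrow> smooth_on (cmap c ` (cdom c \<inter> cdom d)) (cmap d \<circ> cinv c)"
  using atlas unfolding smooth_atlas_def by blast

lemma transition_differentiable: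
  assumes "c \<in> A" "d \<in> A" "p \<in> cdom c" "p \<in> cdom d"
  shows "(cmap d \<circ> cinv c) differentiable (at (cmap c p))"
  using smooth_on_differentiable[OF smooth_transition[OF assms(1,2)]] assms by blast

text \<open>The cocycle identity of the Jacobians: on the image of the triple overlap, an open set,
  the composite of two changes of charts is the third. With \<open>chart_at A p\<close> as one of
  the charts it yields the rules for components and coordinate fields.\<close>

lemma transition_chain:
  assumes "c \<in> A" "d \<in> A" "e \<in> A" "p \<in> cdom c" "p \<in> cdom d" "p \<in> cdom e"
  shows "frechet_derivative (cmap e \<circ> cinv d) (at (cmap d p))
      (frechet_derivative (cmap d \<circ> cinv c) (at (cmap c p)) u) =
    frechet_derivative (cmap e \<circ> cinv c) (at (cmap c p)) u"
proof -
  let ?U = "cmap c ` (cdom c \<inter> cdom d \<inter> cdom e)"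
  have D1: "(cmap d \<circ> cinv c) differentiable (at (cmap c p))"
    using transition_differentiable assms by blast
  have D2: "(cmap e \<circ> cinv d) differentiable (at ((cmap d \<circ> cinv c) (cmap c p)))"
    using transition_differentiable assms by (simp add: cinv_cmap)
  have "frechet_derivative ((cmap e \<circ> cinv d) \<circ> (cmap d \<circ> cinv c)) (at (cmap c p)) =
      frechet_derivative (cmap e \<circ> cinv c) (at (cmap c p))"
  proof (rule frechet_derivative_cong_open(1))
    show "open ?U" using assms by (intro open_cmap_image open_Int open_cdom) auto
    show "cmap c p \<in> ?U" using assms by blast
    show "((cmap e \<circ> cinv d) \<circ> (cmap d \<circ> cinv c)) y = (cmap e \<circ> cinv c) y" if "y \<in> ?U" for y
      using that assms by (auto simp: cinv_cmap)
    show "((cmap e \<circ> cinv d) \<circ> (cmap d \<circ> cinv c)) differentiable (at (cmap c p))"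
      using D1 D2 by (rule differentiable_chain_at)
  qed
  then show ?thesis
    unfolding frechet_derivative_compose[OF D1 D2] using assms by (simp add: cinv_cmap fun_eq_iff)
qed

lemma transition_self:
  assumes "c \<in> A" "p \<in> cdom c"
  shows "frechet_derivative (cmap c \<circ> cinv c) (at (cmap c p)) u = u"
proof -
  have "frechet_derivative (\<lambda>x. x) (at (cmap c p)) =
      frechet_derivative (cmap c \<circ> cinv c) (at (cmap c p))"
    by (rule frechet_derivative_cong_open(1)[of "cmap c ` cdom c"])
      (use assms in \<open>auto simp: open_cmap_image open_cdom cinv_cmap\<close>)
  then show ?thesis by (metis frechet_derivative_ident)
qed

lemma components_linear:
  assumes "c \<in> A" "p \<in> cdom c"
  shows "linear (components A c p)"
proof -
  have "linear (frechet_derivative (cmap c \<circ> cinv (chart_at A p)) (at (cmap (chart_at A p) p)))"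
    using assms chart_at_mem by (intro linear_frechet_derivative transition_differentiable) auto
  then show ?thesis unfolding components_def[abs_def] .
qed

lemma coord_field_linear:
  assumes "c \<in> A" "p \<in> cdom c"
  shows "linear (\<lambda>u. coord_field A c u p)"
  unfolding coord_field_def
  by (rule linear_frechet_derivative[OF transition_differentiable])
    (use assms chart_at_mem in auto)

lemma components_coord_field:
  assumes "c \<in> A" "d \<in> A" "p \<in> cdom c" "p \<in> cdom d"
  shows "components A d p (coord_field A c u p) =
    frechet_derivative (cmap d \<circ> cinv c) (at (cmap c p)) u"
  unfolding components_def coord_field_def
  by (rule transition_chain) (use assms chart_at_mem in auto)

lemma coord_field_components:
  assumes "c \<in> A" "p \<in> cdom c"
  shows "coord_field A c (components A c p v) p = v"
  unfolding components_def coord_field_def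
  using transition_chain[of "chart_at A p" c "chart_at A p" p v] transition_self assms chart_at_mem
  by simp

lemma components_chart_at: "components A (chart_at A p) p v = v"
  unfolding components_def by (rule transition_self) (rule chart_at_mem)+

lemma coord_field_chart_at: "coord_field A (chart_at A p) u p = u"
  unfolding coord_field_def by (rule transition_self) (rule chart_at_mem)+

lemma coord_field_expand:
  assumes "c \<in> A" "p \<in> cdom c"
  shows "v = (\<Sum>b\<in>Basis. (components A c p v \<bullet> b) *\<^sub>R coord_field A c b p)"
proof -
  interpret linear "\<lambda>u. coord_field A c u p" by (rule coord_field_linear[OF assms])
  have "coord_field A c (\<Sum>b\<in>Basis. (components A c p v \<bullet> b) *\<^sub>R b) p = v"
    by (simp add: euclidean_representation coord_field_components[OF assms])
  then show ?thesis by (simp add: sum scaleR)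
qed

text \<open>The two coordinate expressions differ by a change of charts. The values of f are
  arbitrary vectors, so this serves for real functions and also for the components of a
  field.\<close>

lemma smooth_on_change_chart:
  assumes "c \<in> A" "d \<in> A" "open U" "smooth_on (cmap c ` (U \<inter> cdom c)) (f \<circ> cinv c)"
  shows "smooth_on (cmap d ` (U \<inter> cdom c \<inter> cdom d)) (f \<circ> cinv d)"
proof (rule smooth_on_cong)
  show o: "open (cmap d ` (U \<inter> cdom c \<inter> cdom d))"
    using assms by (intro open_cmap_image open_Int open_cdom) auto
  show "smooth_on (cmap d ` (U \<inter> cdom c \<inter> cdom d)) ((f \<circ> cinv c) \<circ> (cmap c \<circ> cinv d))"
    using assms(1,2) by (intro smooth_on_compose[OF o _ assms(4)]
        smooth_on_subset[OF smooth_transition]) (auto simp: cinv_cmap)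
  show "((f \<circ> cinv c) \<circ> (cmap c \<circ> cinv d)) x = (f \<circ> cinv d) x"
    if "x \<in> cmap d ` (U \<inter> cdom c \<inter> cdom d)" for x
    using that assms(1,2) by (auto simp: cinv_cmap)
qed

lemma smooth_fun_chartI:
  assumes "c \<in> A" "open U" "U \<subseteq> cdom c" "smooth_on (cmap c ` U) (f \<circ> cinv c)"
  shows "smooth_fun A U f"
proof -
  have "U \<inter> cdom c = U" using assms(3) by blast
  then show ?thesis
    unfolding smooth_fun_def using smooth_on_change_chart[OF assms(1) _ assms(2), of _ f] assms(4)
    by simp
qed

lemma smooth_fun_cong:
  assumes "open U" "smooth_fun A U f" "\<And>x. x \<in> U \<Longrightarrow> f x = f' x"
  shows "smooth_fun A U f'"
  unfolding smooth_fun_def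
proof
  fix c assume c: "c \<in> A"
  show "smooth_on (cmap c ` (U \<inter> cdom c)) (f' \<circ> cinv c)"
    by (rule smooth_on_cong[of _ "f \<circ> cinv c"])
      (use assms c in \<open>auto simp: smooth_fun_def cinv_cmap intro!: open_cmap_image open_cdom\<close>)
qed

lemma smooth_fun_const: "smooth_fun A U (\<lambda>x. k)"
  unfolding smooth_fun_def comp_def by (simp add: smooth_on_const)

lemma smooth_field_cong:
  assumes "open U" "smooth_field A U X" "\<And>x. x \<in> U \<Longrightarrow> X x = Y x"
  shows "smooth_field A U Y"
  unfolding smooth_field_def
proof
  fix c assume c: "c \<in> A"
  show "smooth_on (cmap c ` (U \<inter> cdom c)) (\<lambda>x. components A c (cinv c x) (Y (cinv c x)))"
    by (rule smooth_on_cong[of _ "\<lambda>x. components A c (cinv c x) (X (cinv c x))"])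
      (use assms c in \<open>auto simp: smooth_field_def cinv_cmap intro!: open_cmap_image open_cdom\<close>)
qed

lemma smooth_field_zero: "open U \<Longrightarrow> smooth_field A U (\<lambda>x. 0)"
  unfolding smooth_field_def
proof
  fix c assume "open U" and c: "c \<in> A"
  then show "smooth_on (cmap c ` (U \<inter> cdom c)) (\<lambda>x. components A c (cinv c x) 0)"
    by (intro smooth_on_cong[OF open_cmap_image smooth_on_const[of _ 0]])
      (auto simp: open_cdom cinv_cmap linear_0[OF components_linear])
qed

lemma smooth_field_add:
  assumes "open U" "smooth_field A U X" "smooth_field A U Y"
  shows "smooth_field A U (\<lambda>x. X x + Y x)"
  unfolding smooth_field_def
proof
  fix c assume c: "c \<in> A"
  let ?V = "cmap c ` (U \<inter> cdom c)"
  have o: "open ?V" using assms c by (intro open_cmap_image) (auto simp: open_cdom)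
  show "smooth_on ?V (\<lambda>x. components A c (cinv c x) (X (cinv c x) + Y (cinv c x)))"
    by (rule smooth_on_cong[OF o smooth_on_add[OF o assms(2,3)[unfolded smooth_field_def, rule_format, OF c]]])
      (use c in \<open>auto simp: cinv_cmap linear_add[OF components_linear]\<close>)
qed

lemma smooth_field_scaleR:
  assumes "open U" "smooth_fun A U f" "smooth_field A U X"
  shows "smooth_field A U (\<lambda>x. f x *\<^sub>R X x)"
  unfolding smooth_field_def
proof
  fix c assume c: "c \<in> A"
  let ?V = "cmap c ` (U \<inter> cdom c)"
  have o: "open ?V" using assms c by (intro open_cmap_image) (auto simp: open_cdom)
  show "smooth_on ?V (\<lambda>x. components A c (cinv c x) (f (cinv c x) *\<^sub>R X (cinv c x)))"
    by (rule smooth_on_cong[OF o smooth_on_scaleR[OF o assms(2)[unfolded smooth_fun_def, rule_format, OF c]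
            assms(3)[unfolded smooth_field_def, rule_format, OF c]]])
      (use c in \<open>auto simp: cinv_cmap linear_scale[OF components_linear]\<close>)
qed

lemma smooth_field_sum:
  assumes "open U" "finite B" "\<And>b. b \<in> B \<Longrightarrow> smooth_field A U (X b)"
  shows "smooth_field A U (\<lambda>x. \<Sum>b\<in>B. X b x)"
  using assms(2,3)
  by (induction B rule: finite_induct)
    (simp_all add: smooth_field_zero smooth_field_add assms(1))

text \<open>In another chart d the components of a coordinate field of c are a Jacobian of the
  change of charts applied to u. Read in c this is a derivative of a smooth map;
  \<open>smooth_on_change_chart\<close> then moves the statement to d.\<close>

lemma smooth_coord_field:
  assumes c: "c \<in> A"
  shows "smooth_field A (cdom c) (coord_field A c u)"
  unfolding smooth_field_def
proof
  fix d assume d: "d \<in> A"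
  let ?f = "(\<lambda>x. frechet_derivative (cmap d \<circ> cinv c) (at x) u) \<circ> cmap c"
  have o: "open (cmap c ` (cdom d \<inter> cdom c))"
    using c d by (intro open_cmap_image) (auto simp: open_cdom)
  have "smooth_on (cmap c ` (cdom d \<inter> cdom c)) (?f \<circ> cinv c)"
  proof (rule smooth_on_cong[OF o smooth_on_frechet_derivative[OF o, of "cmap d \<circ> cinv c" u]])
    show "smooth_on (cmap c ` (cdom d \<inter> cdom c)) (cmap d \<circ> cinv c)"
      using smooth_transition[OF c d] by (simp add: Int_commute)
  qed (use c in \<open>auto simp: cinv_cmap\<close>)
  then have s: "smooth_on (cmap d ` (cdom c \<inter> cdom d)) (?f \<circ> cinv d)"
    using smooth_on_change_chart[OF c d open_cdom[OF d], of ?f] by (simp add: Int_ac)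
  show "smooth_on (cmap d ` (cdom c \<inter> cdom d)) (\<lambda>x. components A d (cinv d x) (coord_field A c u (cinv d x)))"
    by (rule smooth_on_cong[OF _ s])
      (use c d in \<open>auto simp: open_cmap_image open_cdom open_Int cinv_cmap components_coord_field\<close>)
qed

end

section \<open>Connections along a map\<close>

context
  fixes A :: "('a::{second_countable_topology,t2_space}, 'e::euclidean_space) chart set"
    and nab :: "('a \<Rightarrow> 'e) \<Rightarrow> ('a \<Rightarrow> 'e) \<Rightarrow> 'a \<Rightarrow> 'e"
  assumes atlas: "smooth_atlas A" and conn: "linear_connection A nab"
begin

lemma connection_add:
  assumes "open U" "smooth_field A U X" "smooth_field A U Y" "smooth_field A U Z" "p \<in> U"
  shows "nab X (\<lambda>x. Y x + Z x) p = nab X Y p + nab X Z p"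
  \<comment> \<open>\<open>linear_connection\<close> puts all its laws under one set of hypotheses,
    which includes a smooth function; the constant 0 fills that place.\<close>
  using conn assms smooth_fun_const[OF atlas, of U 0] unfolding linear_connection_def by meson

lemma connection_leibniz:
  assumes "open U" "smooth_field A U X" "smooth_field A U Y" "smooth_fun A U f" "p \<in> U"
  shows "nab X (\<lambda>x. f x *\<^sub>R Y x) p = dir_deriv A p (X p) f *\<^sub>R Y p + f p *\<^sub>R nab X Y p"
  using conn assms unfolding linear_connection_def by meson

text \<open>Multiplying both fields by the indicator function of U makes them equal everywhere.\<close>

lemma connection_local:
  assumes U: "open U" and X: "smooth_field A U X" and Y: "smooth_field A U Y"
    and eq: "\<And>x. x \<in> U \<Longrightarrow> Y x = Z x" and p: "p \<in> U"
  shows "nab X Y p = nab X Z p"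
proof -
  let ?f = "\<lambda>x. if x \<in> U then 1 else 0 :: real"
  have f: "smooth_fun A U ?f"
    by (rule smooth_fun_cong[OF atlas U smooth_fun_const[OF atlas, of _ 1]]) simp
  have Z: "smooth_field A U Z" by (rule smooth_field_cong[OF atlas U Y eq])
  have "(\<lambda>x. ?f x *\<^sub>R Y x) = (\<lambda>x. ?f x *\<^sub>R Z x)" using eq by auto
  with connection_leibniz[OF U X Y f p] connection_leibniz[OF U X Z f p] show ?thesis
    using p eq[OF p] by simp
qed

text \<open>The Leibniz rule for the zero function times the zero field: in each of its two terms
  one factor vanishes.\<close>

lemma connection_zero:
  assumes "open U" "smooth_field A U X" "p \<in> U"
  shows "nab X (\<lambda>x. 0) p = 0"
  using connection_leibniz[OF assms(1,2) smooth_field_zero[OF atlas assms(1)]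
      smooth_fun_const[OF atlas, of _ 0] assms(3)]
  by simp

lemma connection_sum:
  assumes U: "open U" and X: "smooth_field A U X" and p: "p \<in> U" and "finite B"
    and "\<And>b. b \<in> B \<Longrightarrow> smooth_field A U (Y b)" "\<And>b. b \<in> B \<Longrightarrow> smooth_fun A U (f b)"
  shows "nab X (\<lambda>x. \<Sum>b\<in>B. f b x *\<^sub>R Y b x) p =
    (\<Sum>b\<in>B. dir_deriv A p (X p) (f b) *\<^sub>R Y b p + f b p *\<^sub>R nab X (Y b) p)"
  using assms(4-)
proof (induction B rule: finite_induct)
  case empty
  then show ?case using connection_zero[OF U X p] by simp
next
  case (insert b B)
  have s: "smooth_field A U (\<lambda>x. f i x *\<^sub>R Y i x)" if "i \<in> insert b B" for i
    using insert.prems that by (intro smooth_field_scaleR atlas U)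
  have "nab X (\<lambda>x. f b x *\<^sub>R Y b x + (\<Sum>i\<in>B. f i x *\<^sub>R Y i x)) p =
    nab X (\<lambda>x. f b x *\<^sub>R Y b x) p + nab X (\<lambda>x. \<Sum>i\<in>B. f i x *\<^sub>R Y i x) p"
    by (intro connection_add[OF U X _ _ p] smooth_field_sum atlas U s insert.hyps) auto
  then show ?case
    using insert connection_leibniz[OF U X _ _ p, of "Y b" "f b"] by simp
qed

end

text \<open>A column of the matrix of J in the chart c. Its values lie in one fixed vector space
  rather than in varying tangent spaces, so it can be composed with \<iota> and
  differentiated.\<close>

definition J_column ::
  "('a, 'e::euclidean_space) chart set \<Rightarrow> ('a \<Rightarrow> 'e \<Rightarrow> 'e) \<Rightarrow> ('a, 'e) chart \<Rightarrow> 'e \<Rightarrow> 'a \<Rightarrow> 'e" where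
  "J_column A J c b p = components A c p (J p (coord_field A c b p))"

section \<open>The almost complex structure in charts and along a map\<close>

context
  fixes A :: "('a::{second_countable_topology,t2_space}, 'e::euclidean_space) chart set"
    and J :: "'a \<Rightarrow> 'e \<Rightarrow> 'e"
  assumes atlas: "smooth_atlas A" and J: "almost_complex A J"
begin

lemma smooth_J_column:
  assumes "c \<in> A"
  shows "smooth_on (cmap c ` cdom c) (J_column A J c b \<circ> cinv c)"
proof -
  have "smooth_field A (cdom c) (\<lambda>p. J p (coord_field A c b p))"
    using J smooth_coord_field[OF atlas assms] open_cdom[OF atlas assms]
    unfolding almost_complex_def by blast
  then show ?thesis using assms by (auto simp: smooth_field_def J_column_def comp_def)
qed

lemma components_J:
  assumes "c \<in> A" "p \<in> cdom c"
  shows "components A c p (J p v) = (\<Sum>b\<in>Basis. (components A c p v \<bullet> b) *\<^sub>R J_column A J c b p)"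
proof -
  have L: "linear (\<lambda>v. components A c p (J p v))"
    using linear_compose[OF _ components_linear[OF atlas assms]] J
    unfolding almost_complex_def comp_def by blast
  interpret linear "\<lambda>v. components A c p (J p v)" by (rule L)
  have "components A c p (J p v) =
      components A c p (J p (\<Sum>b\<in>Basis. (components A c p v \<bullet> b) *\<^sub>R coord_field A c b p))"
    using coord_field_expand[OF atlas assms, of v] by simp
  then show ?thesis by (simp add: sum scaleR J_column_def)
qed

context
  fixes M :: "('b::{second_countable_topology,t2_space}, 'd::euclidean_space) chart set"
    and \<iota> :: "'b \<Rightarrow> 'a"
  assumes atlasM: "smooth_atlas M" and map: "smooth_map M A \<iota>"
begin

lemma open_chart_preimage:
  assumes "d \<in> M" "c \<in> A"
  shows "open (cmap d ` (cdom d \<inter> \<iota> -` cdom c))"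
  using map assms unfolding smooth_map_def
  by (intro open_cmap_image[OF atlasM] open_Int open_cdom[OF atlasM] open_vimage
      open_cdom[OF atlas]) auto

lemma smooth_J_column_along:
  assumes "d \<in> M" "c \<in> A"
  shows "smooth_on (cmap d ` (cdom d \<inter> \<iota> -` cdom c)) (J_column A J c b \<circ> \<iota> \<circ> cinv d)"
proof (rule smooth_on_cong[OF open_chart_preimage[OF assms]])
  show "smooth_on (cmap d ` (cdom d \<inter> \<iota> -` cdom c))
      ((J_column A J c b \<circ> cinv c) \<circ> (cmap c \<circ> \<iota> \<circ> cinv d))"
    using map assms unfolding smooth_map_def
    by (intro smooth_on_compose[OF open_chart_preimage _ smooth_J_column])
      (auto simp: cinv_cmap[OF atlasM])
qed (use assms in \<open>auto simp: cinv_cmap[OF atlasM] cinv_cmap[OF atlas]\<close>)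

text \<open>\<open>almost_complex\<close> tests smoothness on fields on open subsets only. For W
  along \<iota> the components of J W are the smooth matrix of J, pulled back by \<iota>, times the
  components of W.\<close>

lemma smooth_along_J:
  assumes W: "smooth_along M A \<iota> UNIV W"
  shows "smooth_along M A \<iota> UNIV (\<lambda>p. J (\<iota> p) (W p))"
  unfolding smooth_along_def
proof (intro ballI)
  fix d c assume dc: "d \<in> M" "c \<in> A"
  let ?V = "cmap d ` (cdom d \<inter> \<iota> -` cdom c)"
  have "smooth_on ?V (\<lambda>x. components A c (\<iota> (cinv d x)) (W (cinv d x)))"
    using W dc unfolding smooth_along_def by simp
  then have "smooth_on ?V (\<lambda>x. \<Sum>b\<in>Basis. (components A c (\<iota> (cinv d x)) (W (cinv d x)) \<bullet> b) *\<^sub>R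
      (J_column A J c b \<circ> \<iota> \<circ> cinv d) x)"
    by (intro smooth_on_sum smooth_on_scaleR smooth_on_inner smooth_J_column_along
        open_chart_preimage dc finite_Basis)
  then have "smooth_on ?V (\<lambda>x. components A c (\<iota> (cinv d x)) (J (\<iota> (cinv d x)) (W (cinv d x))))"
    by (rule smooth_on_cong[OF open_chart_preimage[OF dc]])
      (use dc in \<open>auto simp: cinv_cmap[OF atlasM] components_J\<close>)
  then show "smooth_on (cmap d ` (UNIV \<inter> cdom d \<inter> \<iota> -` cdom c))
      (\<lambda>x. components A c (\<iota> (cinv d x)) (J (\<iota> (cinv d x)) (W (cinv d x))))" by simp
qed

lemma differential_linear: "linear (differential M A \<iota> p)"
proof -
  let ?d = "chart_at M p" and ?c = "chart_at A (\<iota> p)"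
  have "smooth_on (cmap ?d ` (cdom ?d \<inter> \<iota> -` cdom ?c)) (cmap ?c \<circ> \<iota> \<circ> cinv ?d)"
    using map chart_at_mem[OF atlas] chart_at_mem[OF atlasM] unfolding smooth_map_def by blast
  then show ?thesis
    unfolding differential_def[abs_def]
    by (intro linear_frechet_derivative smooth_on_differentiable)
      (use chart_at_mem[OF atlas] chart_at_mem[OF atlasM] in auto)
qed

text \<open>The components of J W are the sum over b of the b-th component of W times the column
  \<open>K b\<close>. Differentiating them along v gives J applied to the derivative of W plus a
  term with the derivatives \<open>K'\<close> of the columns. Parallelism of J on coordinate fields
  produces the same \<open>K'\<close> term on the other side, and the remaining terms agree by
  linearity.\<close>

lemma induced_connection_J:
  assumes conn: "linear_connection A nab"
    and parallel: "\<And>U X Y p. open U \<Longrightarrow> smooth_field A U X \<Longrightarrow> smooth_field A U Y \<Longrightarrow> p \<in> U \<Longrightarrow>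
      nab X (\<lambda>x. J x (Y x)) p = J p (nab X Y p)"
    and W: "smooth_along M A \<iota> UNIV W" and X: "X p \<in> tangent_bundle M A \<iota> p"
  shows "induced_connection M A \<iota> nab X (\<lambda>x. J (\<iota> x) (W x)) p =
    J (\<iota> p) (induced_connection M A \<iota> nab X W p)"
proof -
  define c d v where "c = chart_at A (\<iota> p)" and "d = chart_at M p"
    and "v = inv (differential M A \<iota> p) (X p)"
  define w where "w = (\<lambda>x. components A c (\<iota> x) (W x))"
  define V where "V = cmap d ` (cdom d \<inter> \<iota> -` cdom c)"
  \<comment> \<open>The field with constant components through the single vector \<open>X p\<close>:
    \<open>nab\<close> acts on fields of Mbar, and X is given only along \<iota>.\<close>
  define E where "E = coord_field A c (X p)"
  define K where "K = J_column A J c"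
  define w' where "w' = frechet_derivative (w \<circ> cinv d) (at (cmap d p)) v"
  define K' where "K' b = frechet_derivative (K b \<circ> cinv c) (at (cmap c (\<iota> p))) (X p)" for b
  have c: "c \<in> A" "\<iota> p \<in> cdom c" and d: "d \<in> M" "p \<in> cdom d"
    using chart_at_mem[OF atlas] chart_at_mem[OF atlasM] by (auto simp: c_def d_def)
  have V: "open V" "cmap d p \<in> V"
    unfolding V_def using open_chart_preimage c d by auto
  have Jlin: "linear (J (\<iota> p))" using J unfolding almost_complex_def by blast
  interpret Jl: linear "J (\<iota> p)" by (rule Jlin)
  have comp: "components A c (\<iota> p) u = u" and coord: "coord_field A c u (\<iota> p) = u" for u
    unfolding c_def by (simp_all add: components_chart_at[OF atlas] coord_field_chart_at[OF atlas])
  have Kp: "K b (\<iota> p) = J (\<iota> p) b" for b unfolding K_def J_column_def by (simp add: comp coord)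
  have wp: "w p = W p" by (simp add: w_def comp)
  have diff_v: "differential M A \<iota> p v = X p"
    unfolding v_def using X by (simp add: tangent_bundle_def f_inv_into_f)
  have dw: "(w \<circ> cinv d) differentiable (at (cmap d p))"
    using W c d V(2) unfolding smooth_along_def w_def V_def comp_def
    by (intro smooth_on_differentiable[of "cmap d ` (UNIV \<inter> cdom d \<inter> \<iota> -` cdom c)"]) auto
  have dK: "(K b \<circ> cinv c) differentiable (at (cmap c (\<iota> p)))" for b
    unfolding K_def using c by (intro smooth_on_differentiable[OF smooth_J_column]) auto
  have dmap: "(cmap c \<circ> \<iota> \<circ> cinv d) differentiable (at (cmap d p))"
    using map c d V(2) unfolding V_def smooth_map_def
    by (intro smooth_on_differentiable[of "cmap d ` (cdom d \<inter> \<iota> -` cdom c)"]) auto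
  \<comment> \<open>The columns are functions on Mbar pulled back to M. As the differential of
    \<iota> sends v to \<open>X p\<close>, their derivative along v is the derivative on Mbar along
    \<open>X p\<close>, the one occurring in the Leibniz rule.\<close>
  have KD: "(K b \<circ> \<iota> \<circ> cinv d) differentiable (at (cmap d p))"
    "frechet_derivative (K b \<circ> \<iota> \<circ> cinv d) (at (cmap d p)) v = K' b" for b
  proof -
    have p': "(cmap c \<circ> \<iota> \<circ> cinv d) (cmap d p) = cmap c (\<iota> p)"
      using d by (simp add: cinv_cmap[OF atlasM])
    let ?f = "(K b \<circ> cinv c) \<circ> (cmap c \<circ> \<iota> \<circ> cinv d)"
    have eq: "?f x = (K b \<circ> \<iota> \<circ> cinv d) x" if "x \<in> V" for x
      using that c d by (auto simp: V_def cinv_cmap[OF atlasM] cinv_cmap[OF atlas])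
    have f: "?f differentiable (at (cmap d p))"
      using dmap dK p' by (metis differentiable_chain_at)
    show "(K b \<circ> \<iota> \<circ> cinv d) differentiable (at (cmap d p))"
      by (rule frechet_derivative_cong_open(2)[OF V eq f])
    have "frechet_derivative ?f (at (cmap d p)) v = K' b"
      using frechet_derivative_compose[OF dmap, of "K b \<circ> cinv c"] dK diff_v
      unfolding p' K'_def differential_def c_def[symmetric] d_def[symmetric] by simp
    then show "frechet_derivative (K b \<circ> \<iota> \<circ> cinv d) (at (cmap d p)) v = K' b"
      using frechet_derivative_cong_open(1)[OF V eq f] by metis
  qed
  \<comment> \<open>Parallelism in coordinates: J of a coordinate field is expanded in coordinate
    fields with the entries of \<open>K b\<close> as coefficients, and the Leibniz rule
    differentiates these.\<close>
  have nabJ: "J (\<iota> p) (nab E (coord_field A c b) (\<iota> p)) =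
      K' b + (\<Sum>a\<in>Basis. (J (\<iota> p) b \<bullet> a) *\<^sub>R nab E (coord_field A c a) (\<iota> p))" for b
  proof -
    let ?U = "cdom c"
    have U: "open ?U" using open_cdom[OF atlas] c by blast
    have E: "smooth_field A ?U E" and F: "smooth_field A ?U (coord_field A c a)" for a
      unfolding E_def using smooth_coord_field[OF atlas] c by blast+
    have f: "smooth_fun A ?U (\<lambda>x. K b x \<bullet> a)" for a
      unfolding K_def comp_def
      by (rule smooth_fun_chartI[OF atlas c(1) U order.refl])
        (use smooth_on_inner[OF _ smooth_J_column[OF c(1), of b], of a] open_cmap_image[OF atlas c(1) U]
          in \<open>simp add: comp_def\<close>)
    have dd: "dir_deriv A (\<iota> p) (E (\<iota> p)) (\<lambda>x. K b x \<bullet> a) = K' b \<bullet> a" for a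
    proof -
      have "((\<lambda>x. (K b \<circ> cinv c) x \<bullet> a) has_derivative
          (\<lambda>u. frechet_derivative (K b \<circ> cinv c) (at (cmap c (\<iota> p))) u \<bullet> a)) (at (cmap c (\<iota> p)))"
        using dK[of b] unfolding frechet_derivative_works by (rule has_derivative_inner_left)
      from fun_cong[OF frechet_derivative_at[OF this, symmetric], of "X p"] show ?thesis
        unfolding dir_deriv_def c_def[symmetric] E_def coord K'_def comp_def .
    qed
    have "J (\<iota> p) (nab E (coord_field A c b) (\<iota> p)) =
        nab E (\<lambda>x. J x (coord_field A c b x)) (\<iota> p)"
      using parallel[OF U E F c(2)] by simp
    also have "\<dots> = nab E (\<lambda>x. \<Sum>a\<in>Basis. (K b x \<bullet> a) *\<^sub>R coord_field A c a x) (\<iota> p)"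
    proof (rule connection_local[OF atlas conn U E _ _ c(2)])
      show "smooth_field A ?U (\<lambda>x. J x (coord_field A c b x))"
        using J U F unfolding almost_complex_def by blast
      show "J x (coord_field A c b x) = (\<Sum>a\<in>Basis. (K b x \<bullet> a) *\<^sub>R coord_field A c a x)"
        if "x \<in> ?U" for x
        unfolding K_def J_column_def by (rule coord_field_expand[OF atlas c(1) that])
    qed
    also have "\<dots> = (\<Sum>a\<in>Basis. (K' b \<bullet> a) *\<^sub>R a) +
        (\<Sum>a\<in>Basis. (J (\<iota> p) b \<bullet> a) *\<^sub>R nab E (coord_field A c a) (\<iota> p))"
      using connection_sum[OF atlas conn U E c(2) finite_Basis, of "coord_field A c"
          "\<lambda>a x. K b x \<bullet> a"] F f by (simp add: dd coord Kp sum.distrib)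
    finally show ?thesis by (simp add: euclidean_representation)
  qed
  have "frechet_derivative ((\<lambda>x. components A c (\<iota> x) (J (\<iota> x) (W x))) \<circ> cinv d) (at (cmap d p)) v
      = (\<Sum>b\<in>Basis. (W p \<bullet> b) *\<^sub>R K' b + (w' \<bullet> b) *\<^sub>R J (\<iota> p) b)"
  proof -
    let ?g = "\<lambda>x. \<Sum>b\<in>Basis. ((w \<circ> cinv d) x \<bullet> b) *\<^sub>R (K b \<circ> \<iota> \<circ> cinv d) x"
    have D: "(?g has_derivative (\<lambda>u. \<Sum>b\<in>Basis. ((w \<circ> cinv d) (cmap d p) \<bullet> b) *\<^sub>R
          frechet_derivative (K b \<circ> \<iota> \<circ> cinv d) (at (cmap d p)) u +
        (frechet_derivative (w \<circ> cinv d) (at (cmap d p)) u \<bullet> b) *\<^sub>R (K b \<circ> \<iota> \<circ> cinv d) (cmap d p)))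
        (at (cmap d p))"
      using dw KD(1)
      by (intro has_derivative_sum has_derivative_scaleR has_derivative_inner_left)
        (simp_all only: frechet_derivative_works[symmetric])
    have "frechet_derivative ((\<lambda>x. components A c (\<iota> x) (J (\<iota> x) (W x))) \<circ> cinv d) (at (cmap d p)) =
        frechet_derivative ?g (at (cmap d p))"
    proof (rule sym, rule frechet_derivative_cong_open(1)[OF V])
      show "?g differentiable (at (cmap d p))" using D differentiable_def by blast
      show "?g x = ((\<lambda>x. components A c (\<iota> x) (J (\<iota> x) (W x))) \<circ> cinv d) x" if "x \<in> V" for x
        using that c d
        by (auto simp: V_def w_def K_def cinv_cmap[OF atlasM] components_J)
    qed
    then show ?thesis
      unfolding frechet_derivative_at[OF D, symmetric]
      using d by (simp add: KD(2) cinv_cmap[OF atlasM] wp Kp w'_def)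
  qed
  moreover have "(\<Sum>b\<in>Basis. (w' \<bullet> b) *\<^sub>R J (\<iota> p) b) = J (\<iota> p) w'"
  proof -
    have "J (\<iota> p) (\<Sum>b\<in>Basis. (w' \<bullet> b) *\<^sub>R b) = (\<Sum>b\<in>Basis. (w' \<bullet> b) *\<^sub>R J (\<iota> p) b)"
      by (simp only: Jl.sum Jl.scaleR)
    then show ?thesis by (simp add: euclidean_representation)
  qed
  \<comment> \<open>Both sides are the same double sum over the matrix entries of J at
    \<open>\<iota> p\<close>, summed in opposite orders.\<close>
  moreover have "(\<Sum>a\<in>Basis. (J (\<iota> p) (W p) \<bullet> a) *\<^sub>R nab E (coord_field A c a) (\<iota> p)) =
      (\<Sum>b\<in>Basis. (W p \<bullet> b) *\<^sub>R (\<Sum>a\<in>Basis. (J (\<iota> p) b \<bullet> a) *\<^sub>R nab E (coord_field A c a) (\<iota> p)))"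
  proof -
    have "J (\<iota> p) (\<Sum>b\<in>Basis. (W p \<bullet> b) *\<^sub>R b) = (\<Sum>b\<in>Basis. (W p \<bullet> b) *\<^sub>R J (\<iota> p) b)"
      by (simp only: Jl.sum Jl.scaleR)
    then have "J (\<iota> p) (W p) = (\<Sum>b\<in>Basis. (W p \<bullet> b) *\<^sub>R J (\<iota> p) b)"
      by (simp add: euclidean_representation)
    then have "(\<Sum>a\<in>Basis. (J (\<iota> p) (W p) \<bullet> a) *\<^sub>R nab E (coord_field A c a) (\<iota> p)) =
      (\<Sum>a\<in>Basis. \<Sum>b\<in>Basis. ((W p \<bullet> b) * (J (\<iota> p) b \<bullet> a)) *\<^sub>R nab E (coord_field A c a) (\<iota> p))"
      by (simp only: inner_sum_left inner_scaleR_left scaleR_sum_left)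
    also have "\<dots> =
      (\<Sum>b\<in>Basis. \<Sum>a\<in>Basis. ((W p \<bullet> b) * (J (\<iota> p) b \<bullet> a)) *\<^sub>R nab E (coord_field A c a) (\<iota> p))"
      by (rule sum.swap)
    finally show ?thesis by (simp add: scaleR_sum_right)
  qed
  moreover have "J (\<iota> p) (\<Sum>b\<in>Basis. (W p \<bullet> b) *\<^sub>R nab E (coord_field A c b) (\<iota> p)) =
      (\<Sum>b\<in>Basis. (W p \<bullet> b) *\<^sub>R K' b) +
      (\<Sum>b\<in>Basis. (W p \<bullet> b) *\<^sub>R (\<Sum>a\<in>Basis. (J (\<iota> p) b \<bullet> a) *\<^sub>R nab E (coord_field A c a) (\<iota> p)))"
    by (simp add: Jl.sum Jl.scaleR nabJ scaleR_add_right sum.distrib)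
  ultimately show ?thesis
    unfolding induced_connection_def Let_def c_def[symmetric] d_def[symmetric] v_def[symmetric]
      E_def[symmetric] comp
    by (simp add: Jl.add sum.distrib w'_def[unfolded w_def, symmetric])
qed

end

end

section \<open>Linear algebra in a fibre\<close>

lemma subspace_ssum: "subspace V \<Longrightarrow> subspace W \<Longrightarrow> subspace (ssum V W)"
  unfolding ssum_def by (rule subspace_sums)

lemma ssumI: "v \<in> V \<Longrightarrow> w \<in> W \<Longrightarrow> v + w \<in> ssum V W"
  unfolding ssum_def by blast

lemma ssumE:
  assumes "x \<in> ssum V W"
  obtains v w where "v \<in> V" "w \<in> W" "x = v + w"
  using assms unfolding ssum_def by blast

lemma direct_sum_0:
  assumes "direct_sum E V W" "subspace W" "v \<in> V" "w \<in> W" "v + w = 0"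
  shows "v = 0" "w = 0"
proof -
  have "v = - w" using assms(5) by (simp add: eq_neg_iff_add_eq_0)
  then have "v \<in> V \<inter> W" using assms(2,3,4) by (simp add: subspace_neg)
  then show "v = 0" using assms(1) unfolding direct_sum_def by blast
  then show "w = 0" using assms(5) by simp
qed

text \<open>\<open>component\<close> is a definite description; the trivial intersection supplies
  the uniqueness that evaluates it.\<close>

lemma component_eq:
  assumes "subspace V" "subspace W" "V \<inter> W = {0}" "x \<in> V"
  shows "component V W x = x"
  unfolding component_def
proof (rule the_equality)
  show "x \<in> V \<and> x - x \<in> W" using assms by (simp add: subspace_0)
  fix v assume "v \<in> V \<and> x - v \<in> W"
  then have "x - v \<in> V \<inter> W" using assms(1,4) by (simp add: subspace_diff)
  then show "v = x" unfolding assms(3) by simp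
qed

text \<open>By duality \<open>\<beta> (\<xi> i) x\<close> is the coefficient of \<open>N i\<close>
  in x. This holds on the vectors \<open>N j\<close> and extends linearly to their span.\<close>

lemma dual_span_eq_0:
  fixes \<beta> :: "'e::real_vector \<Rightarrow> 'e \<Rightarrow> real" and r :: nat
  assumes lin: "\<And>v. linear (\<beta> v)"
    and dual: "\<And>i j. i < r \<Longrightarrow> j < r \<Longrightarrow> \<beta> (\<xi> i) (N j) = (if i = j then 1 else 0)"
    and x: "x \<in> span (N ` {..<r})" and orth: "\<And>i. i < r \<Longrightarrow> \<beta> (\<xi> i) x = 0"
  shows "x = 0"
proof -
  have "x = (\<Sum>i<r. \<beta> (\<xi> i) x *\<^sub>R N i)"
  proof (rule linear_eq_on_span[OF linear_ident _ _ x])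
    show "linear (\<lambda>x. \<Sum>i<r. \<beta> (\<xi> i) x *\<^sub>R N i)"
      by (rule linearI) (simp_all add: linear_add[OF lin] linear_scale[OF lin]
          scaleR_add_left sum.distrib scaleR_sum_right)
    fix y assume "y \<in> N ` {..<r}"
    then obtain j where j: "j < r" "y = N j" by blast
    have "(\<Sum>i<r. \<beta> (\<xi> i) y *\<^sub>R N i) = (\<Sum>i<r. if i = j then N i else 0)"
      using j by (intro sum.cong) (auto simp: dual)
    then show "y = (\<Sum>i<r. \<beta> (\<xi> i) y *\<^sub>R N i)" using j by simp
  qed
  then show ?thesis using orth by simp
qed

text \<open>The hypotheses at one point, where only linear algebra is left. \<open>K1\<close> and
  \<open>K2\<close> are the inner sums whose existence \<open>stcr\<close> asserts;
  \<open>pairing\<close> is the consequence of the dual frames that \<open>T_tr\<close>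
  needs.\<close>

locale stcr_fibre =
  fixes \<beta> :: "'e::euclidean_space \<Rightarrow> 'e \<Rightarrow> real" and J :: "'e \<Rightarrow> 'e"
    and T ST SP Lt D1 D2 D0 D' L1 L2 S K1 K2 :: "'e set"
  assumes bilin: "bilinear \<beta>" and sym: "\<beta> v w = \<beta> w v"
    and Jlin: "linear J" and JJ: "J (J v) = - v"
    and subspaces: "subspace T" "subspace ST" "subspace SP" "subspace Lt" "subspace D1" "subspace D2"
      "subspace D0" "subspace D'" "subspace L1" "subspace L2" "subspace S"
    and nondeg: "nondegenerate_on \<beta> ST"
    and T_sum: "orth_sum \<beta> T ST (T \<inter> orth_compl \<beta> T)"
    and N_sum: "orth_sum \<beta> (orth_compl \<beta> T) SP (T \<inter> orth_compl \<beta> T)"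
    and Lt_sum: "direct_sum (orth_compl \<beta> (ssum ST SP)) (T \<inter> orth_compl \<beta> T) Lt"
    and pairing: "\<lbrakk>x \<in> Lt; \<And>\<rho>. \<rho> \<in> T \<inter> orth_compl \<beta> T \<Longrightarrow> \<beta> \<rho> x = 0\<rbrakk> \<Longrightarrow> x = 0"
    and R_sum: "direct_sum (T \<inter> orth_compl \<beta> T) D1 D2"
    and JD1: "J ` D1 \<subseteq> ST" and JD2: "J ` D2 \<subseteq> SP"
    and sub: "D0 \<subseteq> ST" "D' \<subseteq> ST" "L1 \<subseteq> Lt" "S \<subseteq> SP"
    and K1: "direct_sum K1 (J ` D1) D'" "orth_sum \<beta> ST K1 D0"
    and JD0: "J ` D0 = D0"
    and JD': "orth_sum \<beta> (J ` D') L1 S"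
    and L: "direct_sum Lt L1 L2"
    and JL1: "J ` L1 \<subseteq> ST" and JL2: "J ` L2 \<subseteq> SP"
    and K2: "direct_sum K2 (J ` D2) (J ` L2)" "orth_sum \<beta> SP K2 S"
begin

text \<open>\<open>Dt\<close> and \<open>DD\<close> are the fibres of the paper's \<open>D\<close> with a tilde and \<open>D\<close>.\<close>

abbreviation "Rad \<equiv> T \<inter> orth_compl \<beta> T"
abbreviation "Dt \<equiv> ssum (ssum D2 (J ` L1)) (J ` S)"
abbreviation "DD \<equiv> ssum (ssum D0 D1) (J ` D1)"
abbreviation "tr \<equiv> ssum Lt SP"

sublocale J: linear J by (rule Jlin)

lemma subspace_J: "subspace V \<Longrightarrow> subspace (J ` V)"
  by (rule linear_subspace_image[OF Jlin])

lemmas spaces = subspaces subspace_J[OF subspaces(5)] subspace_J[OF subspaces(6)]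
  subspace_J[OF subspaces(9)] subspace_J[OF subspaces(10)] subspace_J[OF subspaces(11)]

lemma subspace_Dt: "subspace Dt" and subspace_DD: "subspace DD" and subspace_tr: "subspace tr"
  using spaces by (auto intro!: subspace_ssum)

lemma subspace_Rad: "subspace Rad"
proof -
  have "subspace (orth_compl \<beta> T)"
    unfolding orth_compl_def subspace_def
    using bilin by (auto simp: bilinear_rzero bilinear_radd bilinear_rmul)
  then show ?thesis using subspaces(1) subspace_inter by blast
qed

lemma in_T: "v \<in> ST \<Longrightarrow> v \<in> T" "v \<in> Rad \<Longrightarrow> v \<in> T"
  using T_sum ssumI[of v ST 0 Rad] subspace_0[OF subspace_Rad]
  unfolding orth_sum_def direct_sum_def by auto

lemma in_Rad: "v \<in> D1 \<Longrightarrow> v \<in> Rad" "w \<in> D2 \<Longrightarrow> w \<in> Rad"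
proof -
  have R: "Rad = ssum D1 D2" using R_sum unfolding direct_sum_def by blast
  show "v \<in> D1 \<Longrightarrow> v \<in> Rad" "w \<in> D2 \<Longrightarrow> w \<in> Rad"
    using ssumI[of v D1 0 D2] ssumI[of 0 D1 w D2] spaces subspace_0 unfolding R by auto
qed

lemma in_tr: "v \<in> Lt \<Longrightarrow> v \<in> tr" "w \<in> SP \<Longrightarrow> w \<in> tr"
  using ssumI[of v Lt 0 SP] ssumI[of 0 Lt w SP] spaces subspace_0 by auto

lemma in_Dt: "v \<in> D2 \<Longrightarrow> v \<in> Dt" "v \<in> L1 \<Longrightarrow> J v \<in> Dt" "v \<in> S \<Longrightarrow> J v \<in> Dt"
proof -
  note s = subspace_0[OF spaces(6)] subspace_0[OF spaces(14)] subspace_0[OF spaces(16)]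
  show "v \<in> D2 \<Longrightarrow> v \<in> Dt" using ssumI[OF ssumI[OF _ s(2)] s(3)] by simp
  show "v \<in> L1 \<Longrightarrow> J v \<in> Dt" using ssumI[OF ssumI[OF s(1)] s(3)] by simp
  show "v \<in> S \<Longrightarrow> J v \<in> Dt" using ssumI[OF ssumI[OF s(1,2)]] by simp
qed

lemma in_DD: "v \<in> D0 \<Longrightarrow> v \<in> DD" "v \<in> D1 \<Longrightarrow> v \<in> DD" "v \<in> D1 \<Longrightarrow> J v \<in> DD"
proof -
  note s = subspace_0[OF spaces(7)] subspace_0[OF spaces(5)] subspace_0[OF spaces(12)]
  show "v \<in> D0 \<Longrightarrow> v \<in> DD" using ssumI[OF ssumI[OF _ s(2)] s(3)] by simp
  show "v \<in> D1 \<Longrightarrow> v \<in> DD" using ssumI[OF ssumI[OF s(1)] s(3)] by simp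
  show "v \<in> D1 \<Longrightarrow> J v \<in> DD" using ssumI[OF ssumI[OF s(1,2)]] by simp
qed

text \<open>The assumption describes the image of D' under J. Applying J once more turns it, up to
  sign, into a description of D' itself, so that the part of D-tilde outside the radical lies in the
  screen.\<close>

lemma J_D': "\<lbrakk>l \<in> L1; s \<in> S\<rbrakk> \<Longrightarrow> J l + J s \<in> D'"
proof -
  assume "l \<in> L1" "s \<in> S"
  then have "l + s \<in> J ` D'" using JD' ssumI unfolding orth_sum_def direct_sum_def by blast
  then obtain d where d: "d \<in> D'" "l + s = J d" by blast
  have "J l + J s = J (l + s)" by (simp add: J.add)
  also have "\<dots> = - d" unfolding d JJ ..
  finally show ?thesis using d subspaces by (simp add: subspace_neg)
qed

lemma DtE:
  assumes "x \<in> Dt"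
  obtains d l s where "d \<in> D2" "l \<in> L1" "s \<in> S" "x = d + J l + J s"
  using assms unfolding ssum_def by blast

lemma DDE:
  assumes "x \<in> DD"
  obtains a c d where "a \<in> D0" "c \<in> D1" "d \<in> D1" "x = a + c + J d"
  using assms unfolding ssum_def by blast

lemma Dt_T: "x \<in> Dt \<Longrightarrow> x \<in> T"
proof (elim DtE)
  fix d l s assume h: "d \<in> D2" "l \<in> L1" "s \<in> S" "x = d + J l + J s"
  have "J l + J s \<in> T" using J_D'[OF h(2,3)] sub in_T by blast
  then show "x \<in> T"
    using in_T(2)[OF in_Rad(2)[OF h(1)]] subspaces(1) by (simp add: h(4) add.assoc subspace_add)
qed

lemma DD_T: "x \<in> DD \<Longrightarrow> x \<in> T"
  by (elim DDE) (use in_T in_Rad JD1 subspaces(1) sub in \<open>auto intro!: subspace_add\<close>)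

lemma J_Dt: "x \<in> Dt \<Longrightarrow> J x \<in> tr"
proof (elim DtE)
  fix d l s assume h: "d \<in> D2" "l \<in> L1" "s \<in> S" "x = d + J l + J s"
  have "J x = J d - l - s" by (simp add: h J.add JJ)
  also have "\<dots> \<in> tr"
    using h JD2 sub in_tr subspace_tr by (auto intro!: subspace_diff)
  finally show "J x \<in> tr" .
qed

lemma J_DD: "x \<in> DD \<Longrightarrow> J x \<in> DD"
proof (elim DDE)
  fix a c d assume h: "a \<in> D0" "c \<in> D1" "d \<in> D1" "x = a + c + J d"
  have "J x = J a + J c - d" by (simp add: h J.add JJ)
  also have "\<dots> \<in> DD"
    using h JD0 in_DD subspace_DD by (intro subspace_diff subspace_add) auto
  finally show "J x \<in> DD" .
qed

text \<open>Write v as s + \<rho> in TM and as l + t in the transversal space. Since \<rho>, l and t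
  are orthogonal to the screen, nondegeneracy gives s = 0. Since t and v are orthogonal to the
  radical, so is l, and the dual pairing gives l = 0. Then v = t = \<rho> lies in both summands of
  the normal space.\<close>

lemma T_tr: "T \<inter> tr = {0}"
proof -
  have "v = 0" if v: "v \<in> T" "v \<in> tr" for v
  proof -
    have "v \<in> ssum ST Rad" using v(1) T_sum unfolding orth_sum_def direct_sum_def by blast
    then obtain s \<rho> where s: "s \<in> ST" "\<rho> \<in> Rad" "v = s + \<rho>" by (rule ssumE)
    obtain l t where l: "l \<in> Lt" "t \<in> SP" "v = l + t" using v(2) by (auto elim: ssumE)
    have t: "t \<in> orth_compl \<beta> T"
      using l(2) N_sum ssumI[of t SP 0 Rad] subspace_0[OF subspace_Rad]
      unfolding orth_sum_def direct_sum_def by auto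
    have l': "l \<in> orth_compl \<beta> (ssum ST SP)"
      using l(1) Lt_sum ssumI[of 0 Rad l Lt] subspace_0[OF subspace_Rad]
      unfolding direct_sum_def by auto
    have "\<beta> s w = 0" if w: "w \<in> ST" for w
    proof -
      have "\<beta> w l = 0"
        using l' ssumI[OF w, of 0 SP] subspace_0 subspaces(3) unfolding orth_compl_def by auto
      moreover have "\<beta> w t = 0" "\<beta> w \<rho> = 0"
        using t s(2) in_T(1)[OF w] unfolding orth_compl_def by auto
      moreover have "\<beta> w s + \<beta> w \<rho> = \<beta> w l + \<beta> w t"
        using s(3) l(3) bilinear_radd[OF bilin] by metis
      ultimately show ?thesis using sym[of w s] by simp
    qed
    then have s0: "s = 0" using nondeg s(1) unfolding nondegenerate_on_def by blast
    have "\<beta> \<sigma> l = 0" if \<sigma>: "\<sigma> \<in> Rad" for \<sigma>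
    proof -
      have "\<beta> \<sigma> t = 0" "\<beta> \<sigma> v = 0"
        using t \<sigma> v(1) sym[of v \<sigma>] unfolding orth_compl_def by auto
      then show ?thesis using l(3) bilinear_radd[OF bilin, of \<sigma> l t] by simp
    qed
    then have l0: "l = 0" using pairing l(1) by blast
    have "v \<in> SP \<inter> Rad" using s l s0 l0 by simp
    then show "v = 0" using N_sum unfolding orth_sum_def direct_sum_def by blast
  qed
  then show ?thesis using subspace_0[OF subspaces(1)] subspace_0[OF subspace_tr] by auto
qed

text \<open>The summands of D and D-tilde are spread over the two parts of TM: D0, J D1 and D' lie
  in the screen, D1 and D2 in the radical. Comparing the two parts separately reduces the claim to
  the given direct sums.\<close>

lemma DD_Dt: "DD \<inter> Dt = {0}"
proof -
  have "x = 0" if x: "x \<in> DD" "x \<in> Dt" for x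
  proof -
    obtain a c d where h: "a \<in> D0" "c \<in> D1" "d \<in> D1" "x = a + c + J d" using x(1) by (rule DDE)
    obtain e l s where k: "e \<in> D2" "l \<in> L1" "s \<in> S" "x = e + J l + J s" using x(2) by (rule DtE)
    \<comment> \<open>The screen part of the second expression for x, moved to the other side; it
      lies in D'.\<close>
    define m where "m = - (J l + J s)"
    have m: "m \<in> D'" unfolding m_def by (rule subspace_neg[OF subspaces(8) J_D'[OF k(2,3)]])
    have Jdm: "J d + m \<in> K1" 
      using K1(1) ssumI[OF imageI[OF h(3)] m] unfolding direct_sum_def by simp
    have 1: "(J d + m + a) + (c - e) = 0"
    proof -
      have "J d + m + a + (c - e) = (a + c + J d) - (e + J l + J s)"
        unfolding m_def by (simp add: algebra_simps)
      then show ?thesis unfolding h(4)[symmetric] k(4)[symmetric] by simp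
    qed
    have Tds: "direct_sum T ST Rad" and Sds: "direct_sum ST K1 D0"
      using T_sum K1(2) unfolding orth_sum_def by blast+
    have "J d + m + a \<in> ST" 
      using Sds ssumI[OF Jdm h(1)] unfolding direct_sum_def by simp
    moreover have "c - e \<in> Rad" using in_Rad h k subspace_Rad by (intro subspace_diff) auto
    ultimately have 2: "J d + m + a = 0" "c + (- e) = 0"
      using direct_sum_0[OF Tds subspace_Rad _ _ 1] by simp_all
    have "c = 0"
      using direct_sum_0(1)[OF R_sum subspaces(6) h(2) _ 2(2)] k(1) subspaces(6)
      by (simp add: subspace_neg)
    moreover have "a = 0" "J d + m = 0"
      using direct_sum_0[OF Sds subspaces(7) Jdm h(1) 2(1)] by simp_all
    moreover have "J d = 0"
      using direct_sum_0(1)[OF K1(1) subspaces(8) _ m \<open>J d + m = 0\<close>] h(3) by simp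
    ultimately show "x = 0" using h(4) by simp
  qed
  then show ?thesis using subspace_0[OF subspace_DD] subspace_0[OF subspace_Dt] by auto
qed

text \<open>Splitting the screen and the radical leaves pieces in D0, J D1, D1, D2 and D'. Only the
  piece in D' is not visibly in D or D-tilde; J^2 = -1 and J D' = L1 + S rewrite it as an element of
  J L1 + J S.\<close>

lemma T_decompose:
  assumes "x \<in> T"
  obtains d e where "d \<in> DD" "e \<in> Dt" "x = d + e"
proof -
  have "x \<in> ssum ST Rad" using assms T_sum unfolding orth_sum_def direct_sum_def by blast
  then obtain s \<rho> where s: "s \<in> ST" "\<rho> \<in> Rad" "x = s + \<rho>" by (rule ssumE)
  obtain k a where k: "k \<in> K1" "a \<in> D0" "s = k + a"
    using s(1) K1(2) unfolding orth_sum_def direct_sum_def by (auto elim: ssumE)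
  obtain c m where c: "c \<in> D1" "m \<in> D'" "k = J c + m"
    using k(1) K1(1) unfolding direct_sum_def by (auto elim: ssumE)
  have "J m \<in> ssum L1 S" using c(2) JD' unfolding orth_sum_def direct_sum_def by blast
  then obtain l t where l: "l \<in> L1" "t \<in> S" "J m = l + t" by (rule ssumE)
  have "- m = J (l + t)" unfolding l(3)[symmetric] JJ ..
  then have m: "m = - (J l + J t)" by (metis J.add minus_minus)
  obtain u w where u: "u \<in> D1" "w \<in> D2" "\<rho> = u + w"
    using s(2) R_sum unfolding direct_sum_def by (auto elim: ssumE)
  show thesis
  proof (rule that)
    show "a + u + J c \<in> DD" using k c u by (simp add: ssumI)
    show "w - (J l + J t) \<in> Dt"
      using u l in_Dt subspace_Dt by (intro subspace_diff subspace_add) auto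
    show "x = a + u + J c + (w - (J l + J t))" using s k c m u by (simp add: algebra_simps)
  qed
qed

text \<open>The transversal space is composed of L1, L2, J D2, J L2 and S. Under J the first, third
  and fifth go to J L1, D2 and J S, all inside D-tilde, while L2 and J L2 go to J L2 and L2 and stay
  transversal.\<close>

lemma J_tr:
  assumes "x \<in> tr"
  obtains e t where "e \<in> Dt" "t \<in> tr" "J x = e + t"
proof -
  obtain l s where l: "l \<in> Lt" "s \<in> SP" "x = l + s" using assms by (rule ssumE)
  obtain l1 l2 where l12: "l1 \<in> L1" "l2 \<in> L2" "l = l1 + l2"
    using l(1) L unfolding direct_sum_def by (auto elim: ssumE)
  obtain k z where k: "k \<in> K2" "z \<in> S" "s = k + z"
    using l(2) K2(2) unfolding orth_sum_def direct_sum_def by (auto elim: ssumE)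
  have "k \<in> ssum (J ` D2) (J ` L2)" using k(1) K2(1) unfolding direct_sum_def by blast
  then obtain d m where d: "d \<in> D2" "m \<in> L2" "k = J d + J m" by (auto elim: ssumE)
  have m: "m \<in> Lt"
    using L ssumI[OF subspace_0[OF subspaces(9)] d(2)] unfolding direct_sum_def by simp
  show thesis
  proof (rule that)
    show "J l1 - d + J z \<in> Dt"
      using l12 d k in_Dt subspace_Dt by (intro subspace_diff subspace_add) auto
    show "J l2 - m \<in> tr"
      using l12 m JL2 in_tr subspace_tr by (intro subspace_diff) auto
    show "J x = J l1 - d + J z + (J l2 - m)"
      by (simp add: l l12 k d J.add JJ)
  qed
qed

text \<open>The tangential part of the equation shows that \<open>a\<close> and \<open>- J d\<close>, with \<open>d\<close> the DD-component
  of \<open>n\<close>, differ by an element of Dt.\<close>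

lemma tangential_iff:
  assumes "a \<in> T" "n \<in> T" "v \<in> tr" "w \<in> tr" "- a + w = J (n + v)"
  shows "n \<in> Dt \<longleftrightarrow> a \<in> Dt"
proof -
  obtain d e where d: "d \<in> DD" "e \<in> Dt" "n = d + e" using T_decompose[OF assms(2)] .
  obtain e' t where t: "e' \<in> Dt" "t \<in> tr" "J v = e' + t" using J_tr[OF assms(3)] .
  \<comment> \<open>Tangent vectors are collected on the left and transversal vectors on the right,
    so that \<open>T_tr\<close> forces both to vanish.\<close>
  have eq: "- a - J d - e' = J e + t - w"
    using assms(5) d(3) t(3) by (simp add: J.add algebra_simps)
  have "- a - J d - e' \<in> T"
    using assms(1) DD_T[OF J_DD[OF d(1)]] Dt_T[OF t(1)] subspaces(1)
    by (intro subspace_diff subspace_neg)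
  moreover have "- a - J d - e' \<in> tr"
    unfolding eq using J_Dt[OF d(2)] t(2) assms(4) subspace_tr
    by (intro subspace_diff subspace_add)
  ultimately have "- a - J d - e' = 0" using T_tr by blast
  moreover have "J d = - a - e' - (- a - J d - e')" "a = - (J d + e') - (- a - J d - e')"
    by simp_all
  ultimately have a: "J d = - a - e'" "a = - (J d + e')" by simp_all
  show ?thesis
  proof
    assume "n \<in> Dt"
    then have "n - e \<in> Dt" using d(2) subspace_Dt by (intro subspace_diff)
    then have "d \<in> DD \<inter> Dt" using d by simp
    then have "d = 0" using DD_Dt by blast
    then show "a \<in> Dt" using a(2) t(1) subspace_Dt by (simp add: subspace_neg J.zero)
  next
    assume "a \<in> Dt"
    then have "J d \<in> Dt" unfolding a(1) using t(1) subspace_Dt by (intro subspace_diff subspace_neg)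
    then have "J d = 0" using J_DD[OF d(1)] DD_Dt by blast
    then have "d = 0" using JJ[of d] by (simp add: J.zero)
    then show "n \<in> Dt" using d by simp
  qed
qed

end

section \<open>From bundles over M to their fibres\<close>

lemma subbundle_subspace:
  assumes "subbundle M A \<iota> E"
  shows "subspace (E p)"
proof -
  obtain k U s where "p \<in> U" "local_frame M A \<iota> E U k s"
    using assms unfolding subbundle_def by metis
  then have "E p = span ((\<lambda>i. s i p) ` {..<k})" unfolding local_frame_def by blast
  then show ?thesis by simp
qed

text \<open>\<open>ltr\<close> is not among the bundles that \<open>screens\<close> and
  \<open>stcr\<close> declare to be subbundles; its local frames, given with the dual frames of the
  radical, take that place.\<close>

lemma lightlike_transversal_subspace:
  assumes "lightlike_transversal M A \<iota> g r STM STMp ltr"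
  shows "subspace (ltr p)"
proof -
  obtain U N where "p \<in> U" "local_frame M A \<iota> ltr U r N"
    using assms unfolding lightlike_transversal_def by metis
  then have "ltr p = span ((\<lambda>i. N i p) ` {..<r})" unfolding local_frame_def by blast
  then show ?thesis by simp
qed

lemma lightlike_transversal_pairing:
  assumes "lightlike_transversal M A \<iota> g r STM STMp ltr" "bilinear (g (\<iota> p))"
    and "x \<in> ltr p" "\<And>\<rho>. \<rho> \<in> radical M A \<iota> g p \<Longrightarrow> g (\<iota> p) \<rho> x = 0"
  shows "x = 0"
proof -
  obtain U \<xi> N where U: "p \<in> U" "local_frame M A \<iota> (radical M A \<iota> g) U r \<xi>"
    "local_frame M A \<iota> ltr U r N"
    "\<forall>x\<in>U. \<forall>i<r. \<forall>j<r. g (\<iota> x) (\<xi> i x) (N j x) = (if i = j then 1 else 0)"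
    using assms(1) unfolding lightlike_transversal_def by metis
  have N: "ltr p = span ((\<lambda>i. N i p) ` {..<r})" and R: "radical M A \<iota> g p = span ((\<lambda>i. \<xi> i p) ` {..<r})"
    using U unfolding local_frame_def by blast+
  show ?thesis
  proof (rule dual_span_eq_0[of "g (\<iota> p)" r "\<lambda>i. \<xi> i p" "\<lambda>i. N i p"])
    show "linear (g (\<iota> p) v)" for v using assms(2) unfolding bilinear_def by blast
    show "g (\<iota> p) (\<xi> i p) (N j p) = (if i = j then 1 else 0)" if "i < r" "j < r" for i j
      using U(1,4) that by blast
    show "x \<in> span ((\<lambda>i. N i p) ` {..<r})" using assms(3) N by simp
    show "g (\<iota> p) (\<xi> i p) x = 0" if "i < r" for i
      using that by (intro assms(4)) (auto simp: R intro: span_base)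
  qed
qed

text \<open>The form with \<open>obtains\<close> reflects that \<open>K1\<close> and
  \<open>K2\<close> are known only to exist at each point.\<close>

lemma stcr_fibre_at:
  assumes kaehler: "indefinite_kaehler A g J nab q"
    and light: "lightlike_submanifold M A \<iota> g r"
    and screens: "screens M A \<iota> g STM STMp"
    and ltr: "lightlike_transversal M A \<iota> g r STM STMp ltr"
    and stcr: "stcr M A \<iota> g J STM STMp ltr D1 D2 D0 D' L1 L2 S"
  obtains K1 K2 where "stcr_fibre (g (\<iota> p)) (J (\<iota> p)) (tangent_bundle M A \<iota> p) (STM p) (STMp p)
    (ltr p) (D1 p) (D2 p) (D0 p) (D' p) (L1 p) (L2 p) (S p) K1 K2"
proof -
  note st = stcr[unfolded stcr_def]
  obtain K1 where K1: "direct_sum K1 (J (\<iota> p) ` D1 p) (D' p)" "orth_sum (g (\<iota> p)) (STM p) K1 (D0 p)"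
    using st by meson
  obtain K2 where K2: "direct_sum K2 (J (\<iota> p) ` D2 p) (J (\<iota> p) ` L2 p)"
    "orth_sum (g (\<iota> p)) (STMp p) K2 (S p)"
    using st by meson
  have sr: "semi_riemannian A g q" and ac: "almost_complex A J"
    using kaehler by (simp_all add: indefinite_kaehler_def)
  have atlas: "smooth_atlas A" and bil: "bilinear (g (\<iota> p))" and sym: "\<And>v w. g (\<iota> p) v w = g (\<iota> p) w v"
    using sr unfolding semi_riemannian_def by blast+
  have J: "linear (J (\<iota> p))" "\<And>v. J (\<iota> p) (J (\<iota> p) v) = - v"
    using ac by (simp_all add: almost_complex_def)
  have atlasM: "smooth_atlas M" and map: "smooth_map M A \<iota>"
    using light unfolding lightlike_submanifold_def immersed_submanifold_def by blast+
  have T: "subspace (tangent_bundle M A \<iota> p)"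
    unfolding tangent_bundle_def
    by (rule linear_subspace_image[OF differential_linear[OF atlas ac atlasM map] subspace_UNIV])
  have rad: "radical M A \<iota> g p =
      tangent_bundle M A \<iota> p \<inter> orth_compl (g (\<iota> p)) (tangent_bundle M A \<iota> p)"
    unfolding radical_def normal_bundle_def ..
  have sc: "nondegenerate_on (g (\<iota> p)) (STM p)" "subspace (STM p)" "subspace (STMp p)"
    "orth_sum (g (\<iota> p)) (tangent_bundle M A \<iota> p) (STM p) (radical M A \<iota> g p)"
    "orth_sum (g (\<iota> p)) (normal_bundle M A \<iota> g p) (STMp p) (radical M A \<iota> g p)"
    using screens subbundle_subspace[of M A \<iota>] by (simp_all add: screens_def)
  have lt: "direct_sum (orth_compl (g (\<iota> p)) (ssum (STM p) (STMp p))) (radical M A \<iota> g p) (ltr p)"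
    using ltr by (simp add: lightlike_transversal_def)
  have ss: "subspace (D1 p)" "subspace (D2 p)" "subspace (D0 p)" "subspace (D' p)" "subspace (L1 p)"
    "subspace (L2 p)" "subspace (S p)"
    using st subbundle_subspace[of M A \<iota>] by simp_all
  have s1: "direct_sum (radical M A \<iota> g p) (D1 p) (D2 p)" "J (\<iota> p) ` D1 p \<subseteq> STM p"
    "J (\<iota> p) ` D2 p \<subseteq> STMp p" "D0 p \<subseteq> STM p" "D' p \<subseteq> STM p" "L1 p \<subseteq> ltr p" "S p \<subseteq> STMp p"
    "J (\<iota> p) ` D0 p = D0 p" "orth_sum (g (\<iota> p)) (J (\<iota> p) ` D' p) (L1 p) (S p)"
    "direct_sum (ltr p) (L1 p) (L2 p)" "J (\<iota> p) ` L1 p \<subseteq> STM p" "J (\<iota> p) ` L2 p \<subseteq> STMp p"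
    using st by simp_all
  note facts = bil sym J T sc ss lt s1 K1 K2 lightlike_transversal_subspace[OF ltr]
    lightlike_transversal_pairing[OF ltr bil]
  show thesis
    by (rule that[of K1 K2], rule stcr_fibre.intro; rule facts[unfolded rad normal_bundle_def]; assumption)
qed

theorem theorem3p7:
  fixes Mbar :: "('a::{second_countable_topology,t2_space}, 'e::euclidean_space) chart set"
    and g :: "'a \<Rightarrow> 'e \<Rightarrow> 'e \<Rightarrow> real"
    and J :: "'a \<Rightarrow> 'e \<Rightarrow> 'e"
    and nab :: "('a \<Rightarrow> 'e) \<Rightarrow> ('a \<Rightarrow> 'e) \<Rightarrow> 'a \<Rightarrow> 'e"
    and M :: "('b::{second_countable_topology,t2_space}, 'd::euclidean_space) chart set"
    and \<iota> :: "'b \<Rightarrow> 'a"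
    and STM STMp ltr D1 D2 D0 D' L1 L2 S :: "'b \<Rightarrow> 'e set"
    and nabM h shape nabt :: "('b \<Rightarrow> 'e) \<Rightarrow> ('b \<Rightarrow> 'e) \<Rightarrow> 'b \<Rightarrow> 'e"
    and q r :: nat
  assumes "indefinite_kaehler Mbar g J nab q"
    and "lightlike_submanifold M Mbar \<iota> g r"
    and "screens M Mbar \<iota> g STM STMp"
    and "lightlike_transversal M Mbar \<iota> g r STM STMp ltr"
    and "stcr M Mbar \<iota> g J STM STMp ltr D1 D2 D0 D' L1 L2 S"
    and "gauss_weingarten M Mbar \<iota> nab (transversal STMp ltr) nabM h shape nabt"
  shows "totally_geodesic_foliation M Mbar \<iota> nabM (D_tilde \<iota> J D2 L1 S) \<longleftrightarrow>
    (\<forall>X\<in>sections M Mbar \<iota> (D_tilde \<iota> J D2 L1 S).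
      \<forall>Y\<in>sections M Mbar \<iota> (D_tilde \<iota> J D2 L1 S).
        shape (omega M Mbar \<iota> J (transversal STMp ltr) Y) X
          \<in> sections M Mbar \<iota> (D_tilde \<iota> J D2 L1 S))"
proof -
  let ?Dt = "D_tilde \<iota> J D2 L1 S" and ?tr = "transversal STMp ltr"
  let ?T = "tangent_bundle M Mbar \<iota>" and ?\<Gamma> = "sections M Mbar \<iota>"
  have sr: "semi_riemannian Mbar g q" and ac: "almost_complex Mbar J"
    and lc: "levi_civita Mbar g nab"
    using assms(1) by (simp_all add: indefinite_kaehler_def)
  have atlas: "smooth_atlas Mbar" and conn: "linear_connection Mbar nab"
    using sr lc by (simp_all add: semi_riemannian_def levi_civita_def)
  have parallel: "\<And>U X Y p. open U \<Longrightarrow> smooth_field Mbar U X \<Longrightarrow> smooth_field Mbar U Y \<Longrightarrow> p \<in> U \<Longrightarrow>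
      nab X (\<lambda>x. J x (Y x)) p = J p (nab X Y p)"
    using assms(1) unfolding indefinite_kaehler_def by blast
  have atlasM: "smooth_atlas M" and map: "smooth_map M Mbar \<iota>"
    using assms(2) unfolding lightlike_submanifold_def immersed_submanifold_def by blast+
  note fibre = stcr_fibre_at[OF assms(1-5)]
  have Dt_T: "?Dt p \<subseteq> ?T p" for p
    by (rule fibre[of p]) (auto simp: D_tilde_def dest: stcr_fibre.Dt_T)
  have J_Dt: "J (\<iota> p) y \<in> ?tr p" if "y \<in> ?Dt p" for p y
    by (rule fibre[of p]) (use that in \<open>auto simp: D_tilde_def transversal_def dest: stcr_fibre.J_Dt\<close>)
  have comp: "component (?tr p) (?T p) y = y" if "y \<in> ?tr p" for p y
  proof (rule fibre[of p])
    fix K1 K2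
    assume f: "stcr_fibre (g (\<iota> p)) (J (\<iota> p)) (?T p) (STM p) (STMp p)
      (ltr p) (D1 p) (D2 p) (D0 p) (D' p) (L1 p) (L2 p) (S p) K1 K2"
    then show ?thesis
      using that stcr_fibre.subspace_tr[OF f] stcr_fibre.T_tr[OF f] stcr_fibre.subspaces(1)[OF f]
      unfolding transversal_def by (intro component_eq) auto
  qed
  have "nabM X Y \<in> ?\<Gamma> ?Dt \<longleftrightarrow> shape (omega M Mbar \<iota> J ?tr Y) X \<in> ?\<Gamma> ?Dt"
    if X: "X \<in> ?\<Gamma> ?Dt" and Y: "Y \<in> ?\<Gamma> ?Dt" for X Y
  proof -
    let ?JY = "\<lambda>p. J (\<iota> p) (Y p)"
    \<comment> \<open>The tr-component of J Y is J Y itself, because J Y is transversal and the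
      decomposition is direct.\<close>
    have om: "omega M Mbar \<iota> J ?tr Y = ?JY"
      unfolding omega_def using Y J_Dt comp by (auto simp: sections_def)
    have XT: "X \<in> ?\<Gamma> ?T" and YT: "Y \<in> ?\<Gamma> ?T"
      using X Y Dt_T unfolding sections_def by blast+
    \<comment> \<open>The Weingarten formula is available for smooth sections only, so
      transversality of J Y at each point does not suffice.\<close>
    have V: "?JY \<in> ?\<Gamma> ?tr"
      using Y J_Dt smooth_along_J[OF atlas ac atlasM map] unfolding sections_def by blast
    have gauss: "nabM X Y \<in> ?\<Gamma> ?T" "h X Y \<in> ?\<Gamma> ?tr"
      "\<And>p. induced_connection M Mbar \<iota> nab X Y p = nabM X Y p + h X Y p"
      using assms(6) XT YT unfolding gauss_weingarten_def Let_def by blast+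
    have weingarten: "shape ?JY X \<in> ?\<Gamma> ?T" "nabt X ?JY \<in> ?\<Gamma> ?tr"
      "\<And>p. induced_connection M Mbar \<iota> nab X ?JY p = - shape ?JY X p + nabt X ?JY p"
      using assms(6) XT V unfolding gauss_weingarten_def Let_def by blast+
    have "nabM X Y p \<in> ?Dt p \<longleftrightarrow> shape ?JY X p \<in> ?Dt p" for p
    proof (rule fibre[of p])
      fix K1 K2
      assume f: "stcr_fibre (g (\<iota> p)) (J (\<iota> p)) (?T p) (STM p) (STMp p)
        (ltr p) (D1 p) (D2 p) (D0 p) (D' p) (L1 p) (L2 p) (S p) K1 K2"
      have "induced_connection M Mbar \<iota> nab X ?JY p = J (\<iota> p) (induced_connection M Mbar \<iota> nab X Y p)"
      proof (rule induced_connection_J[OF atlas ac atlasM map conn])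
        show "nab X (\<lambda>x. J x (Y x)) p = J p (nab X Y p)"
          if "open U" "smooth_field Mbar U X" "smooth_field Mbar U Y" "p \<in> U" for U X Y p
          using that by (rule parallel)
      qed (use XT YT in \<open>auto simp: sections_def\<close>)
      then have "- shape ?JY X p + nabt X ?JY p = J (\<iota> p) (nabM X Y p + h X Y p)"
        unfolding gauss weingarten .
      then show ?thesis
        using stcr_fibre.tangential_iff[OF f, of "shape ?JY X p" "nabM X Y p" "h X Y p" "nabt X ?JY p"]
          gauss(1,2) weingarten(1,2)
        unfolding sections_def D_tilde_def transversal_def by blast
    qed
    then show ?thesis using gauss(1) weingarten(1) unfolding om sections_def by blast
  qed
  then show ?thesis unfolding totally_geodesic_foliation_def by blast
qed

end
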